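(* Let $r\geq 2$ be an integer, let $-\pi<\phi<\pi$, and let $a,w_1,\ldots,w_r\in\mathcal{H}_{\phi}$; put $\boldsymbol{w}=(w_1,\ldots,w_r)$. Let the constants $c_q^{(r)}$ ($q=0,1,2,\ldots$) be defined by \[ \frac{1}{(1+\varepsilon)(2+\varepsilon)\cdots(r-1+\varepsilon)}=\sum_{q=0}^{\infty}c_q^{(r)}\varepsilon^q,\qquad |\varepsilon|<1 . \] Then for each $k=0,1,2,\ldots$, the coefficient $\gamma_k(r,a;\boldsymbol{w})$ of $(s-r)^k$ in the Laurent expansion at $s=r$ of the Barnes multiple zeta function $\zeta_r(s,a;\boldsymbol{w})$ is given by \[ \gamma_k(r,a;\boldsymbol{w})=\lim_{M\to\infty}\Bigg\{\frac{(-1)^k}{k!}\sum_{m_1=0}^M\cdots\sum_{m_r=0}^M\frac{\log^k(a+\boldsymbol{m}\cdot\boldsymbol{w})}{(a+\boldsymbol{m}\cdot\boldsymbol{w})^r} -\frac{1}{w_1\cdots w_r}\sum_{q=0}^{k+1}c_q^{(r)}\frac{(-1)^{k+1-q}}{(k+1-q)!}\sum_{\emptyset\neq I\subseteq\{1,\ldots,r\}}(-1)^{|I|}\log^{k+1-q}\Big(a+\sum_{i\in I}w_iM\Big)\Bigg\}, \] where the limit is taken over positive integers $M$. In particular, \[ \gamma_0(r,a;\boldsymbol{w})=\lim_{M\to\infty}\Bigg\{\sum_{m_1=0}^M\cdots\sum_{m_r=0}^M\frac{1}{(a+\boldsymbol{m}\cdot\boldsymbol{w})^r} +\frac{1}{(r-1)!\,w_1\cdots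 w_r}\sum_{\emptyset\neq I\subseteq\{1,\ldots,r\}}(-1)^{|I|}\log\Big(a+\sum_{i\in I}w_iM\Big)-\frac{H_{r-1}}{(r-1)!\,w_1\cdots w_r}\Bigg\}, \] where $H_{r-1}=1+\frac12+\cdots+\frac1{r-1}$.
   Context: For a fixed real number $-\pi<\phi<\pi$, $\mathcal{H}_{\phi}=\{\rho e^{i\theta}\in\mathbb{C}: \rho>0,\ \phi-\frac{\pi}{2}<\theta<\phi+\frac{\pi}{2}\}$ is an open half-plane, closed under addition and multiplication by positive reals. A fixed, otherwise arbitrary, holomorphic logarithm $\log$ on $\mathcal{H}_{\phi}$ is used throughout, with $z^s=\exp(s\log z)$ for $z\in\mathcal{H}_{\phi}$, $s\in\mathbb{C}$; $\log^n z$ means $(\log z)^n$, with $\log^0 z=1$. For $a,w_1,\ldots,w_r\in\mathcal{H}_{\phi}$, the Barnes multiple zeta function is \[ \zeta_r(s,a;\boldsymbol{w})=\sum_{m_1=0}^{\infty}\cdots\sum_{m_r=0}^{\infty}(a+\boldsymbol{m}\cdot\boldsymbol{w})^{-s},\qquad \boldsymbol{m}\cdot\boldsymbol{w}=m_1w_1+\cdots+m_rw_r, \] which converges absolutely for $\operatorname{Re}s>r$ and continues meromorphically to all $s\in\mathbb{C}$, with only possible singularities simple poles at $s=1,\ldots,r$; the symbol $\zeta_r$ denotes the continued function. The Laurent coefficients at $s=r$ are defined by \[ \zeta_r(s,a;\boldsymbol{w})=\frac{1}{(r-1)!\,w_1\cdots w_r}\frac{1}{s-r}+\sum_{k=0}^\infty\gamma_k(r,a;\boldsymbol{w})(s-r)^k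 . \] *)

theory Defs
  imports "HOL-Complex_Analysis.Complex_Analysis"
begin

definition half_plane :: "real \<Rightarrow> complex set" where
  "half_plane \<phi> = {rcis \<rho> \<theta> | \<rho> \<theta>. \<rho> > 0 \<and> \<phi> - pi / 2 < \<theta> \<and> \<theta> < \<phi> + pi / 2}"

definition holomorphic_log_on :: "(complex \<Rightarrow> complex) \<Rightarrow> complex set \<Rightarrow> bool" where
  "holomorphic_log_on L H \<longleftrightarrow> L holomorphic_on H \<and> (\<forall>z\<in>H. exp (L z) = z)"

text \<open>The power \<open>z\<^sup>s\<close> with respect to the chosen logarithm \<open>L\<close>. The library's \<open>powr\<close> is not
  usable here, as it is tied to the principal branch.\<close>

definition log_power :: "(complex \<Rightarrow> complex) \<Rightarrow> complex \<Rightarrow> complex \<Rightarrow> complex" where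
  "log_power L z s = exp (s * L z)"

text \<open>Multi-indices and the parameter vector \<open>w\<close> are functions of which only the values on
  \<open>{1..r}\<close> matter.\<close>

definition lattice_point ::
    "nat \<Rightarrow> complex \<Rightarrow> (nat \<Rightarrow> complex) \<Rightarrow> (nat \<Rightarrow> nat) \<Rightarrow> complex" where
  "lattice_point r a w m = a + (\<Sum>i = 1..r. of_nat (m i) * w i)"

definition barnes_series ::
    "(complex \<Rightarrow> complex) \<Rightarrow> nat \<Rightarrow> complex \<Rightarrow> (nat \<Rightarrow> complex) \<Rightarrow> complex \<Rightarrow> complex" where
  "barnes_series L r a w s =
     (\<Sum>\<^sub>\<infinity>m \<in> {1..r} \<rightarrow>\<^sub>E (UNIV :: nat set). log_power L (lattice_point r a w m) (- s))"

text \<open>The meromorphic continuation to the whole plane. By the identity theorem there is at most one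
  continuation that is \<^emph>\<open>nicely\<close> meromorphic, i.e. takes the value \<open>0\<close> at its poles and has no
  removable singularities.\<close>

definition barnes_zeta ::
    "(complex \<Rightarrow> complex) \<Rightarrow> nat \<Rightarrow> complex \<Rightarrow> (nat \<Rightarrow> complex) \<Rightarrow> complex \<Rightarrow> complex" where
  "barnes_zeta L r a w =
     (THE f. f nicely_meromorphic_on UNIV \<and>
             (\<forall>s. Re s > real r \<longrightarrow> f s = barnes_series L r a w s))"

definition barnes_gamma ::
    "(complex \<Rightarrow> complex) \<Rightarrow> nat \<Rightarrow> complex \<Rightarrow> (nat \<Rightarrow> complex) \<Rightarrow> nat \<Rightarrow> complex" where
  "barnes_gamma L r a w k = fls_nth (laurent_expansion (barnes_zeta L r a w) (of_nat r)) (int k)"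

end

theory Submission
  imports Defs
begin

text \<open>
  Write \<open>z\<close> for a lattice point \<open>a + m \<bullet> w\<close> and consider the alternating sum
  \<open>\<Sum>\<^sub>I (-1)\<^sup>|\<^sup>I\<^sup>| f(z + w\<^sub>I)\<close> over all subsets \<open>I\<close> of \<open>{1..r}\<close>, where \<open>w\<^sub>I\<close> is the sum of the \<open>w\<^sub>i\<close>
  with \<open>i \<in> I\<close> and \<open>f(x) = x\<^sup>r\<^sup>-\<^sup>s\<close>. It can be evaluated in two ways.

  Summed over the box \<open>{0..M}\<^sup>r\<close> it telescopes to the same alternating sum over the corners of the
  box (\<open>subset_sum_diff_telescope\<close>). These are the logarithmic terms of the limit formula in disguise:
  at \<open>s = r + \<epsilon>\<close> the corner terms are exponentials in \<open>-\<epsilon> log\<close>.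

  Expanded by Taylor's theorem at \<open>z\<close>, it starts with the term of order \<open>r\<close>, because the moments
  \<open>\<Sum>\<^sub>I (-1)\<^sup>|\<^sup>I\<^sup>| w\<^sub>I\<^sup>l\<close> vanish for \<open>l < r\<close> (\<open>subset_sum_diff_power\<close>). That term is
  \<open>w\<^sub>1 \<dots> w\<^sub>r (s - 1) \<dots> (s - r) z\<^sup>-\<^sup>s\<close>, a multiple of the summand of the Barnes series. The next terms are
  multiples of \<open>z\<^sup>-\<^sup>s\<^sup>-\<^sup>k\<close> for \<open>k = 1, 2, \<dots>\<close>, and the remainder after order \<open>N\<close> decays so fast that its sum
  over the lattice is holomorphic for \<open>Re s > 2r - N - 1\<close> (\<open>remainder_dominated\<close>).

  Letting \<open>M\<close> tend to infinity for \<open>Re s > r\<close>, all corners but \<open>a\<close> disappear, and the comparison yields a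
  recurrence (\<open>series_recurrence\<close>) that expresses \<open>(s - 1) \<dots> (s - r) \<zeta>\<^sub>r(s)\<close> by the same function at
  \<open>s + 1, s + 2, \<dots>\<close> and a remainder. Used repeatedly, it continues this function to an entire function
  (\<open>continuation\<close>), so the continued zeta function exists, and it is unique by the identity theorem
  (\<open>barnes_zeta_eq\<close>).

  With \<open>N = r\<close> no further Taylor terms occur, and the remainder sum converges locally uniformly for
  \<open>Re s > r - 1\<close>, a neighbourhood of the pole. Hence near \<open>s = r\<close> the box sums, multiplied by
  \<open>w\<^sub>1 \<dots> w\<^sub>r (s - 1) \<dots> (s - r)\<close> and corrected by the corner terms, converge uniformly to
  \<open>w\<^sub>1 \<dots> w\<^sub>r\<close> times the entire function above (\<open>numerator_uniform_limit\<close>). Uniform convergence of holomorphic functions implies convergence of their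
  Taylor coefficients, and division by \<open>w\<^sub>1 \<dots> w\<^sub>r \<epsilon> (1 + \<epsilon>) \<dots> (r - 1 + \<epsilon>)\<close> turns these into the Laurent coefficients of
  the zeta function; this division is the convolution with the constants \<open>c\<^sub>q\<close>
  (\<open>barnes_gamma_limit\<close>).
\<close>

section \<open>Half-planes, logarithms and complex powers\<close>

lemma half_plane_iff: "z \<in> half_plane \<phi> \<longleftrightarrow> 0 < Re (z * cis (-\<phi>))"
proof
  assume "z \<in> half_plane \<phi>"
  then obtain \<rho> \<theta> where *: "z = rcis \<rho> \<theta>" "\<rho> > 0" "\<phi> - pi / 2 < \<theta>" "\<theta> < \<phi> + pi / 2"
    by (auto simp: half_plane_def)
  have "z * cis (-\<phi>) = rcis \<rho> (\<theta> - \<phi>)"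
    using * by (simp add: rcis_def cis_mult mult.assoc)
  moreover have "cos (\<theta> - \<phi>) > 0"
    using * by (intro cos_gt_zero_pi) auto
  ultimately show "0 < Re (z * cis (-\<phi>))"
    using * by simp
next
  assume *: "0 < Re (z * cis (-\<phi>))"
  define u where "u = z * cis (-\<phi>)"
  have u: "u \<noteq> 0" "\<bar>Arg u\<bar> < pi / 2"
    using * unfolding Arg_Re_pos u_def[symmetric] by auto
  have "z = u * cis \<phi>"
    by (simp add: u_def mult.assoc cis_mult)
  also have "u = rcis (cmod u) (Arg u)"
    using rcis_cmod_Arg by simp
  finally have "z = rcis (cmod u) (\<phi> + Arg u)"
    by (simp add: rcis_def cis_mult mult.assoc add.commute)
  then show "z \<in> half_plane \<phi>"
    using u unfolding half_plane_def
    by (intro CollectI exI[of _ "cmod u"] exI[of _ "\<phi> + Arg u"]) auto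
qed

lemma half_plane_nonzero: "z \<in> half_plane \<phi> \<Longrightarrow> z \<noteq> 0"
  by (auto simp: half_plane_iff)

lemma half_plane_halfspace: "half_plane \<phi> = {z. cis \<phi> \<bullet> z > 0}"
  by (auto simp: half_plane_iff inner_complex_def algebra_simps)

lemma open_half_plane: "open (half_plane \<phi>)"
  by (simp add: half_plane_halfspace open_halfspace_gt)

lemma convex_half_plane: "convex (half_plane \<phi>)"
  by (simp add: half_plane_halfspace convex_halfspace_gt)

lemma holomorphic_log_has_field_derivative:
  assumes "holomorphic_log_on L H" "open H" "z \<in> H"
  shows "(L has_field_derivative 1 / z) (at z)"
proof -
  obtain D where D: "(L has_field_derivative D) (at z)"
    using assms by (metis holomorphic_log_on_def holomorphic_on_open)
  have "((\<lambda>x. exp (L x)) has_field_derivative exp (L z) * D) (at z)"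
    by (rule derivative_eq_intros D refl)+
  moreover have "((\<lambda>x. exp (L x)) has_field_derivative 1) (at z)"
    by (rule has_field_derivative_transform_within_open[OF DERIV_ident assms(2,3)])
       (use assms(1) in \<open>auto simp: holomorphic_log_on_def\<close>)
  ultimately have "exp (L z) * D = 1"
    by (rule DERIV_unique)
  moreover have "exp (L z) = z"
    using assms by (auto simp: holomorphic_log_on_def)
  ultimately show ?thesis
    using D by (metis exp_not_eq_zero nonzero_mult_div_cancel_left)
qed

lemma Re_holomorphic_log: "\<lbrakk>holomorphic_log_on L H; z \<in> H\<rbrakk> \<Longrightarrow> Re (L z) = ln (cmod z)"
  by (metis holomorphic_log_on_def ln_exp norm_exp_eq_Re)

text \<open>On a half-plane any two holomorphic logarithms differ by a constant, and the rotated principal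
  logarithm is one of them.\<close>

lemma Im_holomorphic_log_bounded:
  assumes "holomorphic_log_on L (half_plane \<phi>)"
  obtains K where "K \<ge> 0" "\<And>z. z \<in> half_plane \<phi> \<Longrightarrow> \<bar>Im (L z)\<bar> \<le> K"
proof -
  have "((\<lambda>z. L z - Ln (z * cis (-\<phi>))) has_field_derivative 0) (at z within half_plane \<phi>)"
    if z: "z \<in> half_plane \<phi>" for z
  proof -
    have "((\<lambda>z. L z - Ln (z * cis (-\<phi>))) has_field_derivative
            (1 / z - inverse (z * cis (-\<phi>)) * (1 * cis (-\<phi>)))) (at z)"
      using z by (intro DERIV_diff holomorphic_log_has_field_derivative[OF assms open_half_plane]
          DERIV_fun_exp DERIV_chain2[OF has_field_derivative_Ln]) 
        (auto simp: half_plane_iff complex_nonpos_Reals_iff intro!: derivative_eq_intros)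
    moreover have "1 / z - inverse (z * cis (-\<phi>)) * (1 * cis (-\<phi>)) = 0"
      by (simp add: inverse_eq_divide)
    ultimately have "((\<lambda>z. L z - Ln (z * cis (-\<phi>))) has_field_derivative 0) (at z)"
      by (simp only:)
    then show ?thesis
      by (rule has_field_derivative_at_within)
  qed
  then have "\<exists>c. \<forall>z\<in>half_plane \<phi>. L z - Ln (z * cis (-\<phi>)) = c"
    by (rule has_field_derivative_zero_constant[OF convex_half_plane])
  then obtain c where c: "\<forall>z\<in>half_plane \<phi>. L z - Ln (z * cis (-\<phi>)) = c"
    by (elim exE)
  show ?thesis
  proof (rule that[of "pi + \<bar>Im c\<bar>"])
    fix z assume z: "z \<in> half_plane \<phi>"
    have "L z = Ln (z * cis (-\<phi>)) + c"
      using bspec[OF c z] by (simp add: algebra_simps)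
    moreover have "\<bar>Im (Ln (z * cis (-\<phi>)))\<bar> \<le> pi"
      using half_plane_nonzero[OF z] mpi_less_Im_Ln[of "z * cis (-\<phi>)"]
        Im_Ln_le_pi[of "z * cis (-\<phi>)"] by (simp add: abs_le_iff)
    ultimately show "\<bar>Im (L z)\<bar> \<le> pi + \<bar>Im c\<bar>"
      by simp
  qed simp
qed

lemma norm_log_power:
  assumes "holomorphic_log_on L H" "z \<in> H"
  shows "cmod (log_power L z s) = cmod z powr Re s * exp (- (Im s * Im (L z)))"
proof -
  have "z \<noteq> 0"
    using assms by (metis exp_not_eq_zero holomorphic_log_on_def)
  then show ?thesis
    by (simp add: log_power_def Re_holomorphic_log[OF assms] powr_def flip: exp_add)
qed

lemma log_power_has_field_derivative:
  assumes "holomorphic_log_on L H" "open H" "z \<in> H"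
  shows "((\<lambda>z. log_power L z s) has_field_derivative s * log_power L z (s - 1)) (at z)"
proof -
  have "log_power L z (s - 1) = log_power L z s / z"
    using assms by (simp add: log_power_def left_diff_distrib exp_diff holomorphic_log_on_def)
  moreover have "((\<lambda>z. exp (s * L z)) has_field_derivative exp (s * L z) * (s * (1 / z))) (at z)"
    by (intro DERIV_fun_exp DERIV_cmult holomorphic_log_has_field_derivative[OF assms])
  ultimately show ?thesis
    by (simp add: log_power_def mult_ac)
qed

text \<open>The modulus of \<open>z\<^sup>s\<close> is \<open>\<bar>z\<bar>\<close> to the power \<open>Re s\<close>, times a factor that stays
  bounded for bounded \<open>s\<close> because the logarithm has bounded imaginary part. The number \<open>x\<close> stands for
  the size of a lattice point, so that the lower bound \<open>\<delta> x\<close> for the modulus is all that is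
  known about \<open>z\<close>; exponents with nonpositive real part turn it into an upper bound.\<close>

lemma log_power_bound:
  assumes L: "holomorphic_log_on L (half_plane \<phi>)" and \<delta>: "\<delta> > 0"
  obtains C where "C \<ge> 0"
    "\<And>z s x p. \<lbrakk>z \<in> half_plane \<phi>; cmod z \<ge> \<delta> * x; x \<ge> 1; cmod s \<le> T; Re s \<le> p; p \<le> 0\<rbrakk>
        \<Longrightarrow> cmod (log_power L z s) \<le> C * x powr p"
proof -
  obtain K where K: "K \<ge> 0" "\<And>z. z \<in> half_plane \<phi> \<Longrightarrow> \<bar>Im (L z)\<bar> \<le> K"
    using Im_holomorphic_log_bounded[OF L] by blast
  show ?thesis
  proof (rule that[of "(1 + \<delta> powr (-T)) * exp (T * K)"])
    fix z s and x p :: real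
    assume z: "z \<in> half_plane \<phi>" "cmod z \<ge> \<delta> * x" and x: "x \<ge> 1"
      and s: "cmod s \<le> T" "Re s \<le> p" and p: "p \<le> 0"
    have ReIm: "\<bar>Re s\<bar> \<le> T" "\<bar>Im s\<bar> \<le> T"
      using s abs_Re_le_cmod[of s] abs_Im_le_cmod[of s] by linarith+
    have "- (Im s * Im (L z)) \<le> \<bar>Im s\<bar> * \<bar>Im (L z)\<bar>"
      by (metis abs_ge_minus_self abs_mult)
    also have "\<dots> \<le> T * K"
      using ReIm K(2)[OF z(1)] by (intro mult_mono) auto
    finally have e: "exp (- (Im s * Im (L z))) \<le> exp (T * K)"
      by simp
    have "cmod z powr Re s \<le> (\<delta> * x) powr Re s"
      using z x \<delta> s p by (intro powr_mono2') auto
    also have "\<dots> = \<delta> powr Re s * x powr Re s"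
      using x \<delta> by (simp add: powr_mult)
    also have "\<delta> powr Re s \<le> 1 + \<delta> powr (-T)"
    proof (cases "\<delta> \<ge> 1")
      case True
      then have "\<delta> powr Re s \<le> 1 powr Re s"
        using s p by (intro powr_mono2') auto
      then show ?thesis
        using powr_ge_zero[of \<delta> "-T"] unfolding powr_one_eq_one by linarith
    next
      case False
      then have "\<delta> powr Re s \<le> \<delta> powr (-T)"
        using \<delta> ReIm by (intro powr_mono') auto
      then show ?thesis
        by simp
    qed
    finally have "cmod z powr Re s \<le> (1 + \<delta> powr (-T)) * x powr Re s"
      by (simp add: mult_right_mono)
    also have "x powr Re s \<le> x powr p"
      using x s by (intro powr_mono) auto
    finally have "cmod z powr Re s \<le> (1 + \<delta> powr (-T)) * x powr p"
      by (simp add: mult_left_mono add_nonneg_nonneg)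
    then have "cmod z powr Re s * exp (- (Im s * Im (L z)))
        \<le> ((1 + \<delta> powr (-T)) * x powr p) * exp (T * K)"
      using e by (intro mult_mono) (auto simp: add_nonneg_nonneg)
    then show "cmod (log_power L z s) \<le> (1 + \<delta> powr (-T)) * exp (T * K) * x powr p"
      unfolding norm_log_power[OF L z(1)] by (simp only: mult_ac)
  qed (simp add: add_nonneg_nonneg)
qed

section \<open>Summation over the lattice orthant\<close>

text \<open>By comparing \<open>1 + m\<^sub>1 + \<dots> + m\<^sub>d\<close> with each \<open>1 + m\<^sub>i\<close>, the summand is at most a
  product of \<open>d\<close> one-dimensional terms \<open>(1 + m\<^sub>i)\<close> to the power \<open>p/d < -1\<close>.\<close>

lemma lattice_powr_summable:
  fixes A :: "'a set"
  assumes A: "finite A" and p: "p < - real (card A)"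
  shows "(\<lambda>m. (1 + (\<Sum>i\<in>A. real (m i))) powr p) summable_on (A \<rightarrow>\<^sub>E (UNIV :: nat set))"
proof (cases "A = {}")
  case False
  define q where "q = p / real (card A)"
  have cA: "card A > 0"
    using A False by auto
  have q: "q < -1" "p = q * real (card A)"
    using p cA by (auto simp: q_def field_simps)
  define f where "f = (\<lambda>(i::'a) (n::nat). (1 + real n) powr q)"
  have "summable (\<lambda>n. real (Suc n) powr q)"
    using q by (subst summable_Suc_iff) (simp add: summable_real_powr_iff)
  then have "summable (\<lambda>n. norm ((1 + real n) powr q))"
    by (simp add: add.commute)
  then have "Infinite_Sum.abs_summable_on (\<lambda>n::nat. (1 + real n) powr q) UNIV"
    by (intro norm_summable_imp_summable_on) simp
  then have "Infinite_Set_Sum.abs_summable_on (\<lambda>m. \<Prod>i\<in>A. f i (m i)) (A \<rightarrow>\<^sub>E (UNIV :: nat set))"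
    using A unfolding f_def
    by (intro abs_summable_on_prod_PiE) (simp_all only: abs_summable_equivalent[symmetric], simp_all)
  then have "Infinite_Sum.abs_summable_on (\<lambda>m. \<Prod>i\<in>A. f i (m i)) (A \<rightarrow>\<^sub>E (UNIV :: nat set))"
    by (simp only: abs_summable_equivalent)
  then have "(\<lambda>m. \<Prod>i\<in>A. f i (m i)) summable_on (A \<rightarrow>\<^sub>E (UNIV :: nat set))"
    by (rule Infinite_Sum.abs_summable_summable)
  then show ?thesis
  proof (rule summable_on_comparison_test)
    fix m :: "'a \<Rightarrow> nat"
    define n where "n = 1 + (\<Sum>i\<in>A. real (m i))"
    have n: "n \<ge> 1 + real (m i)" if "i \<in> A" for i
      using member_le_sum[OF that, of "\<lambda>i. real (m i)"] A by (simp add: n_def)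
    have "n \<ge> 1"
      by (auto simp: n_def intro!: sum_nonneg)
    then have "n powr p = (\<Prod>i\<in>A. n powr q)"
      by (simp add: powr_power q(2) mult.commute)
    also have "\<dots> \<le> (\<Prod>i\<in>A. f i (m i))"
      using n q unfolding f_def by (intro prod_mono conjI powr_mono2') auto
    finally show "(1 + (\<Sum>i\<in>A. real (m i))) powr p \<le> (\<Prod>i\<in>A. f i (m i))"
      by (simp add: n_def)
  qed auto
qed auto

text \<open>The boxes exhaust the orthant, so unconditional sums can be computed along them.\<close>

lemma filterlim_boxes_finite_subsets_at_top:
  assumes "finite A"
  shows "filterlim (\<lambda>M. A \<rightarrow>\<^sub>E {0..M}) (finite_subsets_at_top (A \<rightarrow>\<^sub>E (UNIV :: nat set))) sequentially"
  unfolding filterlim_iff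
proof safe
  fix P assume "eventually P (finite_subsets_at_top (A \<rightarrow>\<^sub>E (UNIV :: nat set)))"
  then obtain X where X: "finite X" "X \<subseteq> A \<rightarrow>\<^sub>E UNIV"
    "\<forall>Y. finite Y \<and> X \<subseteq> Y \<and> Y \<subseteq> A \<rightarrow>\<^sub>E UNIV \<longrightarrow> P Y"
    unfolding eventually_finite_subsets_at_top by (elim exE conjE)
  define N where "N = Max (insert 0 ((\<lambda>(m, i). m i) ` (X \<times> A)))"
  have N: "m i \<le> N" if "m \<in> X" "i \<in> A" for m i
    unfolding N_def
  proof (rule Max_ge)
    show "m i \<in> insert 0 ((\<lambda>(m, i). m i) ` (X \<times> A))"
      using that by (intro insertI2 image_eqI[of _ _ "(m, i)"] SigmaI) simp_all
  qed (intro finite.insertI finite_imageI finite_cartesian_product X(1) assms)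
  have "P (A \<rightarrow>\<^sub>E {0..M})" if "M \<ge> N" for M
  proof -
    have "m \<in> A \<rightarrow>\<^sub>E {0..M}" if m: "m \<in> X" for m
    proof (rule PiE_I)
      show "m i \<in> {0..M}" if "i \<in> A" for i
        using N[OF m that] \<open>M \<ge> N\<close> by simp
      show "m i = undefined" if "i \<notin> A" for i
        using subsetD[OF X(2) m] that by (rule PiE_arb)
    qed
    then have "X \<subseteq> A \<rightarrow>\<^sub>E {0..M}"
      by (rule subsetI)
    moreover have "A \<rightarrow>\<^sub>E {0..M} \<subseteq> A \<rightarrow>\<^sub>E UNIV"
      by (rule PiE_mono) simp
    moreover have "finite (A \<rightarrow>\<^sub>E {0..M})"
      using assms by (intro finite_PiE) simp_all
    ultimately show ?thesis
      by (intro X(3)[THEN spec, THEN mp] conjI)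
  qed
  then show "eventually (\<lambda>M. P (A \<rightarrow>\<^sub>E {0..M})) sequentially"
    unfolding eventually_sequentially by (intro exI allI impI)
qed

section \<open>Alternating sums over subsets\<close>

text \<open>The difference operators that send \<open>f\<close> to \<open>z \<mapsto> f(z) - f(z + w\<^sub>i)\<close> commute with each
  other; this is their composition over \<open>i \<in> A\<close>, expanded.\<close>

definition subset_sum_diff :: "nat set \<Rightarrow> (nat \<Rightarrow> complex) \<Rightarrow> (complex \<Rightarrow> complex) \<Rightarrow> complex \<Rightarrow> complex" where
  "subset_sum_diff A w f z = (\<Sum>I\<in>Pow A. (-1) ^ card I * f (z + (\<Sum>i\<in>I. w i)))"

lemma subset_sum_diff_insert:
  assumes "finite A" "x \<notin> A"
  shows "subset_sum_diff (insert x A) w f z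
       = subset_sum_diff A w f z - subset_sum_diff A w f (z + w x)"
proof -
  have inj: "inj_on (insert x) (Pow A)"
    by (rule inj_on_inverseI[of _ "\<lambda>I. I - {x}"]) (use assms in auto)
  have "subset_sum_diff (insert x A) w f z = subset_sum_diff A w f z
      + (\<Sum>I\<in>insert x ` Pow A. (-1) ^ card I * f (z + (\<Sum>i\<in>I. w i)))"
    unfolding subset_sum_diff_def Pow_insert using assms
    by (subst sum.union_disjoint) auto
  also have "(\<Sum>I\<in>insert x ` Pow A. (-1) ^ card I * f (z + (\<Sum>i\<in>I. w i)))
      = (\<Sum>I\<in>Pow A. - ((-1) ^ card I * f (z + w x + (\<Sum>i\<in>I. w i))))"
    unfolding sum.reindex[OF inj] o_def
  proof (intro sum.cong refl)
    fix I assume "I \<in> Pow A"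
    then have "finite I" "x \<notin> I"
      using assms finite_subset by auto
    then show "(-1) ^ card (insert x I) * f (z + (\<Sum>i\<in>insert x I. w i))
        = - ((-1) ^ card I * f (z + w x + (\<Sum>i\<in>I. w i)))"
      by (simp add: add.assoc)
  qed
  finally show ?thesis
    by (simp add: subset_sum_diff_def sum_negf)
qed

text \<open>Summation over a box inverts the difference operators up to boundary terms: it telescopes in
  each coordinate, and only the corners of the box survive.\<close>

lemma subset_sum_diff_telescope:
  assumes "finite A"
  shows "(\<Sum>m\<in>A \<rightarrow>\<^sub>E {0..M}. subset_sum_diff A w f (a + (\<Sum>i\<in>A. of_nat (m i) * w i)))
       = subset_sum_diff A (\<lambda>i. of_nat (M + 1) * w i) f a"
  using assms
proof (induction A arbitrary: f a)
  case empty
  then show ?case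
    by (simp add: subset_sum_diff_def)
next
  case (insert x A)
  define B where "B = A \<rightarrow>\<^sub>E {0..M}"
  define g where "g = (\<lambda>a. subset_sum_diff A (\<lambda>i. of_nat (M + 1) * w i) f a)"
  define z where "z = (\<lambda>m::nat\<Rightarrow>nat. \<Sum>i\<in>A. of_nat (m i) * w i)"
  have inj: "inj_on (\<lambda>(y, m). m(x := y)) ({0..M} \<times> B)"
    using insert.hyps unfolding B_def by (intro inj_combinator) 
  have *: "(\<Sum>i\<in>insert x A. of_nat ((m(x := y)) i) * w i) = of_nat y * w x + z m" for y m
  proof -
    have "(\<Sum>i\<in>A. of_nat ((m(x := y)) i) * w i) = z m"
      unfolding z_def using insert.hyps by (intro sum.cong) auto
    then show ?thesis
      using insert.hyps by simp
  qed
  have "(\<Sum>m\<in>insert x A \<rightarrow>\<^sub>E {0..M}.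
            subset_sum_diff (insert x A) w f (a + (\<Sum>i\<in>insert x A. of_nat (m i) * w i)))
      = (\<Sum>(y, m)\<in>{0..M} \<times> B. subset_sum_diff (insert x A) w f (a + (of_nat y * w x + z m)))"
    unfolding PiE_insert_eq B_def[symmetric] sum.reindex[OF inj]
    by (intro sum.cong refl) (auto simp: * simp del: fun_upd_apply)
  also have "\<dots> = (\<Sum>y\<in>{0..M}. \<Sum>m\<in>B. subset_sum_diff (insert x A) w f (a + (of_nat y * w x + z m)))"
    by (simp add: sum.cartesian_product)
  also have "\<dots> = (\<Sum>y\<in>{0..M}. \<Sum>m\<in>B. subset_sum_diff A w f ((a + of_nat y * w x) + z m)
                        - subset_sum_diff A w f ((a + of_nat (Suc y) * w x) + z m))"
    by (subst subset_sum_diff_insert[OF insert.hyps]) (simp add: algebra_simps)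
  also have "\<dots> = (\<Sum>y\<in>{0..M}. g (a + of_nat y * w x) - g (a + of_nat (Suc y) * w x))"
    unfolding sum_subtractf B_def z_def g_def insert.IH ..
  also have "\<dots> = g a - g (a + of_nat (M + 1) * w x)"
    using sum_Suc_diff'[of 0 "Suc M" "\<lambda>y. - g (a + of_nat y * w x)"]
    by (simp add: atLeastLessThanSuc_atLeastAtMost)
  also have "\<dots> = subset_sum_diff (insert x A) (\<lambda>i. of_nat (M + 1) * w i) f a"
    unfolding g_def by (subst subset_sum_diff_insert[OF insert.hyps]) simp
  finally show ?case .
qed

text \<open>The moments of the alternating sum are read off from the product of the power series
  \<open>1 - exp(w\<^sub>i X) = - w\<^sub>i X + \<dots>\<close>, which starts with \<open>\<Prod>\<^sub>i (- w\<^sub>i) X\<^sup>d\<close>.\<close>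

lemma subset_sum_diff_power:
  assumes A: "finite A" and l: "l \<le> card A"
  shows "subset_sum_diff A w (\<lambda>z. z ^ l) 0
       = (if l = card A then (-1) ^ l * fact l * (\<Prod>i\<in>A. w i) else 0)"
proof -
  define E where "E = (\<lambda>i. fps_shift 1 (1 - fps_exp (w i)))"
  have E: "1 - fps_exp (w i) = E i * fps_X" for i
    unfolding E_def by (intro fps_ext) (auto simp: fps_X_mult_right_nth)
  have E_0: "(\<Prod>i\<in>I. E i) $ 0 = (\<Prod>i\<in>I. - w i)" for I
    by (induction I rule: infinite_finite_induct) (auto simp: E_def)
  have prod_exp: "(\<Prod>i\<in>I. fps_exp (w i)) = fps_exp (\<Sum>i\<in>I. w i)" for I
    by (induction I rule: infinite_finite_induct) (auto simp: fps_exp_add_mult)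
  have "(\<Prod>i\<in>A. 1 - fps_exp (w i)) = (\<Prod>i\<in>A. E i) * fps_X ^ card A"
    by (simp add: E prod.distrib)
  moreover have "(\<Prod>i\<in>A. 1 - fps_exp (w i)) = (\<Sum>I\<in>Pow A. (-1) ^ card I * fps_exp (\<Sum>i\<in>I. w i))"
    unfolding prod_diff_conv_sum[OF A] by (simp add: prod_exp)
  ultimately have "(\<Sum>I\<in>Pow A. (-1) ^ card I * fps_exp (\<Sum>i\<in>I. w i)) $ l
      = ((\<Prod>i\<in>A. E i) * fps_X ^ card A) $ l"
    by simp
  moreover have "((-1) ^ card I * fps_exp (\<Sum>i\<in>I. w i)) $ l
       = (-1) ^ card I * (\<Sum>i\<in>I. w i) ^ l / fact l" for I
  proof -
    have "(-1) ^ card I = fps_const ((-1) ^ card I :: complex)"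
      by (simp flip: fps_const_power fps_const_neg)
    then show ?thesis
      by (simp only: fps_mult_left_const_nth fps_exp_nth times_divide_eq_right of_nat_fact)
  qed
  moreover have "((\<Prod>i\<in>A. E i) * fps_X ^ card A) $ l
      = (if l = card A then (\<Prod>i\<in>A. - w i) else 0)"
    using l by (simp add: fps_X_power_mult_right_nth E_0)
  ultimately have "subset_sum_diff A w (\<lambda>z. z ^ l) 0 / fact l
      = (if l = card A then (\<Prod>i\<in>A. - w i) else 0)"
    by (simp add: subset_sum_diff_def fps_sum_nth sum_divide_distrib)
  then show ?thesis
    by (auto simp: field_simps prod_uminus split: if_splits)
qed
section \<open>Dominated families of functions on the lattice\<close>

definition lattice_size :: "'a set \<Rightarrow> ('a \<Rightarrow> nat) \<Rightarrow> real" where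
  "lattice_size A m = 1 + (\<Sum>i\<in>A. real (m i))"

lemma lattice_size_ge_1: "lattice_size A m \<ge> 1"
  by (auto simp: lattice_size_def intro!: sum_nonneg)

text \<open>A bound by a summable power of the size of the lattice point, uniform on compact sets of the
  parameter. It is the hypothesis of the Weierstrass test in the form in which the test is needed
  here: the sum over the lattice is then a locally uniform limit of box sums, hence holomorphic.\<close>

definition lattice_dominated ::
    "'a set \<Rightarrow> (('a \<Rightarrow> nat) \<Rightarrow> complex \<Rightarrow> complex) \<Rightarrow> complex set \<Rightarrow> bool" where
  "lattice_dominated A f U \<longleftrightarrow> (\<forall>K. compact K \<and> K \<subseteq> U \<longrightarrow>
     (\<exists>C p. p < - real (card A) \<and>
        (\<forall>s\<in>K. \<forall>m\<in>A \<rightarrow>\<^sub>E UNIV. cmod (f m s) \<le> C * lattice_size A m powr p)))"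

lemma lattice_dominated_uniform_limit:
  assumes "lattice_dominated A f U" "finite A" "compact K" "K \<subseteq> U"
  shows "uniform_limit K (\<lambda>X s. \<Sum>m\<in>X. f m s) (\<lambda>s. \<Sum>\<^sub>\<infinity>m\<in>A \<rightarrow>\<^sub>E UNIV. f m s)
           (finite_subsets_at_top (A \<rightarrow>\<^sub>E UNIV))"
proof -
  obtain C p where C: "p < - real (card A)"
    "\<forall>s\<in>K. \<forall>m\<in>A \<rightarrow>\<^sub>E UNIV. cmod (f m s) \<le> C * lattice_size A m powr p"
    using assms unfolding lattice_dominated_def by blast
  show ?thesis
  proof (rule Weierstrass_m_test_general)
    show "cmod (f m s) \<le> C * lattice_size A m powr p" if "m \<in> A \<rightarrow>\<^sub>E UNIV" "s \<in> K" for m s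
      using C(2) that by (simp only:)
    show "(\<lambda>m. C * lattice_size A m powr p) summable_on (A \<rightarrow>\<^sub>E UNIV)"
      unfolding lattice_size_def
      by (rule summable_on_cmult_right, rule lattice_powr_summable) (use assms(2) C(1) in \<open>simp_all only:\<close>)
  qed
qed

lemma lattice_dominated_box_limit:
  assumes "lattice_dominated A f U" "finite A" "compact K" "K \<subseteq> U"
  shows "uniform_limit K (\<lambda>M s. \<Sum>m\<in>A \<rightarrow>\<^sub>E {0..M}. f m s) (\<lambda>s. \<Sum>\<^sub>\<infinity>m\<in>A \<rightarrow>\<^sub>E UNIV. f m s) sequentially"
  using filterlim_compose[OF lattice_dominated_uniform_limit[OF assms]
      filterlim_boxes_finite_subsets_at_top[OF assms(2)]] .

lemma lattice_dominated_box_tendsto: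
  assumes "lattice_dominated A f U" "finite A" "s \<in> U"
  shows "(\<lambda>M. \<Sum>m\<in>A \<rightarrow>\<^sub>E {0..M}. f m s) \<longlonglongrightarrow> (\<Sum>\<^sub>\<infinity>m\<in>A \<rightarrow>\<^sub>E UNIV. f m s)"
  by (rule tendsto_uniform_limitI[OF lattice_dominated_box_limit[OF assms(1,2), of "{s}"]])
     (use assms(3) in simp_all)

lemma lattice_dominated_holomorphic:
  assumes "lattice_dominated A f U" "finite A" "open U" "\<And>m. f m holomorphic_on U"
  shows "(\<lambda>s. \<Sum>\<^sub>\<infinity>m\<in>A \<rightarrow>\<^sub>E UNIV. f m s) holomorphic_on U"
proof (rule holomorphic_on_open[THEN iffD2, OF assms(3)], intro ballI)
  fix z assume "z \<in> U"
  then obtain e where e: "e > 0" "cball z e \<subseteq> U"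
    using assms(3) open_contains_cball by blast
  have holo: "(\<lambda>s. \<Sum>m\<in>A \<rightarrow>\<^sub>E {0..M}. f m s) holomorphic_on U" for M
    by (intro holomorphic_intros assms)
  have "(\<lambda>s. \<Sum>\<^sub>\<infinity>m\<in>A \<rightarrow>\<^sub>E UNIV. f m s) holomorphic_on ball z e"
  proof (rule holomorphic_uniform_limit)
    show "uniform_limit (cball z e) (\<lambda>M s. \<Sum>m\<in>A \<rightarrow>\<^sub>E {0..M}. f m s)
            (\<lambda>s. \<Sum>\<^sub>\<infinity>m\<in>A \<rightarrow>\<^sub>E UNIV. f m s) sequentially"
      using e by (intro lattice_dominated_box_limit[OF assms(1,2)]) auto
    show "\<forall>\<^sub>F M in sequentially. continuous_on (cball z e) (\<lambda>s. \<Sum>m\<in>A \<rightarrow>\<^sub>E {0..M}. f m s) \<and>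
            (\<lambda>s. \<Sum>m\<in>A \<rightarrow>\<^sub>E {0..M}. f m s) holomorphic_on ball z e"
      using holo e
      by (intro always_eventually allI conjI holomorphic_on_imp_continuous_on)
         (meson ball_subset_cball holomorphic_on_subset order_trans)+
  qed (simp_all)
  then show "\<exists>f'. ((\<lambda>s. \<Sum>\<^sub>\<infinity>m\<in>A \<rightarrow>\<^sub>E UNIV. f m s) has_field_derivative f') (at z)"
    using holomorphic_on_open[of "ball z e"] e(1) by (metis centre_in_ball open_ball)
qed

section \<open>Taylor expansion of powers\<close>

text \<open>The falling factorial, which occurs as the factor in the \<open>l\<close>-th derivative
  \<open>falling c l * z\<^sup>c\<^sup>-\<^sup>l\<close> of \<open>z\<^sup>c\<close>.\<close>

definition falling :: "complex \<Rightarrow> nat \<Rightarrow> complex" where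
  "falling c l = (\<Prod>i<l. c - of_nat i)"

lemma log_power_Taylor:
  assumes L: "holomorphic_log_on L H" and H: "open H" "convex H" and z: "z \<in> H" "z + u \<in> H"
    and B: "\<And>x. x \<in> closed_segment z (z + u) \<Longrightarrow> cmod (log_power L x (c - of_nat (Suc n))) \<le> B"
  shows "cmod (log_power L (z + u) c
             - (\<Sum>l\<le>n. falling c l / fact l * u ^ l * log_power L z (c - of_nat l)))
           \<le> cmod (falling c (Suc n)) * B * cmod u ^ Suc n / fact n"
proof -
  define f where "f = (\<lambda>l x. falling c l * log_power L x (c - of_nat l))"
  have seg: "closed_segment z (z + u) \<subseteq> H"
    using z H by (simp add: closed_segment_subset)
  have "cmod (f 0 (z + u) - (\<Sum>l\<le>n. f l z * (z + u - z) ^ l / fact l))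
      \<le> (cmod (falling c (Suc n)) * B) * cmod (z + u - z) ^ Suc n / fact n"
  proof (rule complex_Taylor[of "closed_segment z (z + u)"])
    fix i x assume x: "x \<in> closed_segment z (z + u)"
    have "(f i has_field_derivative falling c i * ((c - of_nat i) * log_power L x (c - of_nat i - 1))) (at x)"
      unfolding f_def using L H(1) subsetD[OF seg x]
      by (intro DERIV_cmult log_power_has_field_derivative)
    moreover have "falling c i * ((c - of_nat i) * log_power L x (c - of_nat i - 1)) = f (Suc i) x"
      by (simp add: f_def falling_def algebra_simps)
    ultimately show "(f i has_field_derivative f (Suc i) x) (at x within closed_segment z (z + u))"
      by (simp only: has_field_derivative_at_within)
  next
    fix x assume x: "x \<in> closed_segment z (z + u)"
    show "cmod (f (Suc n) x) \<le> cmod (falling c (Suc n)) * B"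
      unfolding f_def norm_mult by (rule mult_left_mono[OF B[OF x]]) simp
  qed auto
  then show ?thesis
    by (simp add: f_def falling_def[of _ 0] mult_ac)
qed
section \<open>The Barnes series and its Taylor remainders\<close>

text \<open>The height of \<open>z\<close> is \<open>Re (z * cis (- \<phi>))\<close>. It is additive and positive on the half-plane,
  and at most \<open>\<bar>z\<bar>\<close>, so it gives lower bounds for moduli of sums without any discussion of
  angles.\<close>

locale barnes_data =
  fixes L :: "complex \<Rightarrow> complex" and r :: nat and \<phi> :: real and a :: complex and w :: "nat \<Rightarrow> complex"
  assumes L: "holomorphic_log_on L (half_plane \<phi>)"
    and a: "a \<in> half_plane \<phi>"
    and w: "\<And>i. i \<in> {1..r} \<Longrightarrow> w i \<in> half_plane \<phi>"
begin

abbreviation pt :: "(nat \<Rightarrow> nat) \<Rightarrow> complex" where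
  "pt m \<equiv> lattice_point r a w m"

abbreviation subset_sum :: "nat set \<Rightarrow> complex" where
  "subset_sum I \<equiv> (\<Sum>i\<in>I. w i)"

lemma subset_sum_height:
  assumes "I \<subseteq> {1..r}"
  shows "0 \<le> Re (subset_sum I * cis (-\<phi>))"
  unfolding sum_distrib_right Re_sum
proof (rule sum_nonneg)
  fix i assume "i \<in> I"
  then have "w i \<in> half_plane \<phi>"
    using assms by (intro w) auto
  then show "0 \<le> Re (w i * cis (-\<phi>))"
    unfolding half_plane_iff by (rule less_imp_le)
qed

lemma subset_sum_in_half_plane: "\<lbrakk>I \<subseteq> {1..r}; I \<noteq> {}\<rbrakk> \<Longrightarrow> subset_sum I \<in> half_plane \<phi>"
proof -
  assume I: "I \<subseteq> {1..r}" "I \<noteq> {}"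
  have "0 < (\<Sum>i\<in>I. Re (w i * cis (-\<phi>)))"
    using I w finite_subset[OF I(1)] by (intro sum_pos) (auto simp: half_plane_iff)
  then show ?thesis
    unfolding half_plane_iff sum_distrib_right Re_sum .
qed

lemma half_plane_add_height:
  "\<lbrakk>z \<in> half_plane \<phi>; 0 \<le> Re (u * cis (-\<phi>))\<rbrakk> \<Longrightarrow> z + u \<in> half_plane \<phi>"
  by (simp add: half_plane_iff distrib_right)

text \<open>Moving in a direction of nonnegative height cannot bring \<open>x\<close> closer to the origin than the height
  of the starting point.\<close>

lemma segment_height:
  assumes "x \<in> closed_segment z (z + u)" "0 \<le> Re (u * cis (-\<phi>))"
  shows "Re (z * cis (-\<phi>)) \<le> cmod x"
proof -
  obtain t where t: "0 \<le> t" "x = z + of_real t * u"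
    using assms(1) by (auto simp: closed_segment_def scaleR_conv_of_real algebra_simps)
  have "Re (x * cis (-\<phi>)) = Re (z * cis (-\<phi>)) + t * Re (u * cis (-\<phi>))"
    unfolding t(2) by (simp add: algebra_simps)
  then have "Re (z * cis (-\<phi>)) \<le> Re (x * cis (-\<phi>))"
    using t(1) assms(2) by simp
  also have "\<dots> \<le> cmod (x * cis (-\<phi>))"
    by (rule complex_Re_le_cmod)
  finally show ?thesis
    by (simp add: norm_mult)
qed

text \<open>The smallest of the heights of \<open>a\<close> and the \<open>w\<^sub>i\<close> serves as \<open>\<delta>\<close>.\<close>

lemma lattice_point_height:
  obtains \<delta> where "\<delta> > 0" "\<And>m. \<delta> * lattice_size {1..r} m \<le> Re (pt m * cis (-\<phi>))"
proof -
  define h where "h = (\<lambda>z. Re (z * cis (-\<phi>)))"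
  define \<delta> where "\<delta> = Min (insert (h a) ((\<lambda>i. h (w i)) ` {1..r}))"
  have h_add: "h (x + y) = h x + h y" for x y
    by (simp add: h_def distrib_right)
  have h_scale: "h (of_nat n * x) = real n * h x" for n x
    by (simp add: h_def right_diff_distrib distrib_left mult.assoc)
  have h_sum: "h (sum f I) = (\<Sum>i\<in>I. h (f i))" for f :: "nat \<Rightarrow> complex" and I
    by (simp only: h_def sum_distrib_right Re_sum)
  have h: "h a > 0" "\<And>i. i \<in> {1..r} \<Longrightarrow> h (w i) > 0"
    using a w unfolding h_def half_plane_iff by auto
  have \<delta>: "\<delta> \<le> h a" "\<And>i. i \<in> {1..r} \<Longrightarrow> \<delta> \<le> h (w i)"
    unfolding \<delta>_def by (intro Min_le; simp)+
  have "\<delta> * lattice_size {1..r} m \<le> Re (pt m * cis (-\<phi>))" for m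
  proof -
    have "\<delta> * lattice_size {1..r} m = \<delta> + (\<Sum>i\<in>{1..r}. real (m i) * \<delta>)"
      by (simp add: lattice_size_def distrib_left sum_distrib_left mult.commute)
    also have "\<dots> \<le> h a + (\<Sum>i\<in>{1..r}. real (m i) * h (w i))"
      using \<delta> by (intro add_mono sum_mono mult_left_mono) auto
    also have "\<dots> = h (pt m)"
      by (simp add: h_add h_scale h_sum lattice_point_def)
    finally show ?thesis
      by (simp add: h_def)
  qed
  moreover have "\<delta> > 0"
    unfolding \<delta>_def using h by (subst Min_gr_iff) auto
  ultimately show ?thesis
    using that by blast
qed

lemma lattice_point_in_half_plane: "pt m \<in> half_plane \<phi>"
proof -
  obtain \<delta> where \<delta>: "\<delta> > 0" "\<And>m. \<delta> * lattice_size {1..r} m \<le> Re (pt m * cis (-\<phi>))"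
    using lattice_point_height by blast
  have "0 < \<delta> * lattice_size {1..r} m"
    using \<delta>(1) lattice_size_ge_1[of "{1..r}" m] by simp
  then show ?thesis
    unfolding half_plane_iff using \<delta>(2)[of m] by linarith
qed

definition moment :: "nat \<Rightarrow> complex" where
  "moment l = subset_sum_diff {1..r} w (\<lambda>z. z ^ l) 0"

text \<open>The alternating subset sum of \<open>x \<mapsto> x\<^sup>r\<^sup>-\<^sup>s\<close> at a lattice point, minus its Taylor expansion through
  order \<open>N\<close>. The exponent \<open>r - s\<close> is chosen so that the first nonzero term of the expansion,
  that of order \<open>r\<close>, is a multiple of the summand \<open>z\<^sup>-\<^sup>s\<close> of the Barnes series.\<close>

definition remainder :: "nat \<Rightarrow> (nat \<Rightarrow> nat) \<Rightarrow> complex \<Rightarrow> complex" where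
  "remainder N m s =
     subset_sum_diff {1..r} w (\<lambda>x. log_power L x (of_nat r - s)) (pt m)
     - (\<Sum>l\<le>N. moment l * falling (of_nat r - s) l / fact l * log_power L (pt m) (of_nat r - s - of_nat l))"

lemma log_power_holomorphic [holomorphic_intros]:
  "f holomorphic_on U \<Longrightarrow> (\<lambda>s. log_power L z (f s)) holomorphic_on U"
  unfolding log_power_def by (intro holomorphic_intros)

lemma falling_holomorphic [holomorphic_intros]:
  "f holomorphic_on U \<Longrightarrow> (\<lambda>s. falling (f s) l) holomorphic_on U"
  unfolding falling_def by (intro holomorphic_intros)

lemma remainder_holomorphic: "remainder N m holomorphic_on U"
  unfolding remainder_def subset_sum_diff_def by (intro holomorphic_intros) auto

text \<open>On a compact set of parameters the exponents \<open>g s\<close> are bounded and their real parts stay below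
  some \<open>p < -r\<close>, which is what makes the bound summable. The segments are those on which
  Taylor's theorem is applied; \<open>u = 0\<close> gives the lattice points themselves.\<close>

lemma log_power_dominated:
  assumes K: "compact K" "g holomorphic_on UNIV" "\<forall>s\<in>K. Re (g s) < - real r"
  shows "\<exists>C p. C \<ge> 0 \<and> p < - real r \<and>
    (\<forall>s\<in>K. \<forall>m u x. 0 \<le> Re (u * cis (-\<phi>)) \<and> x \<in> closed_segment (pt m) (pt m + u)
       \<longrightarrow> cmod (log_power L x (g s)) \<le> C * lattice_size {1..r} m powr p)"
proof -
  have cont: "continuous_on K g"
    using K(2) by (meson holomorphic_on_imp_continuous_on holomorphic_on_subset subset_UNIV)
  obtain p where p: "p < - real r" "\<And>s. s \<in> K \<Longrightarrow> Re (g s) \<le> p"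
  proof (cases "K = {}")
    case True
    then show ?thesis
      using that[of "- real r - 1"] by simp
  next
    case False
    then obtain s0 where "s0 \<in> K" "\<forall>s\<in>K. Re (g s) \<le> Re (g s0)"
      using continuous_attains_sup[OF K(1), of "\<lambda>s. Re (g s)"] cont by (auto intro: continuous_intros)
    then show ?thesis
      using that[of "Re (g s0)"] K(3) by simp
  qed
  obtain T where T: "\<And>s. s \<in> K \<Longrightarrow> cmod (g s) \<le> T"
    using compact_imp_bounded[OF compact_continuous_image[OF cont K(1)]]
    unfolding bounded_iff by (metis imageI)
  obtain \<delta> where \<delta>: "\<delta> > 0" "\<And>m. \<delta> * lattice_size {1..r} m \<le> Re (pt m * cis (-\<phi>))"
    using lattice_point_height by blast
  obtain C where C: "C \<ge> 0"
    "\<And>z s x p. \<lbrakk>z \<in> half_plane \<phi>; cmod z \<ge> \<delta> * x; x \<ge> 1; cmod s \<le> T; Re s \<le> p; p \<le> 0\<rbrakk>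
        \<Longrightarrow> cmod (log_power L z s) \<le> C * x powr p"
    using log_power_bound[OF L \<delta>(1)] by metis
  show ?thesis
  proof (intro exI[of _ C] exI[of _ p] conjI ballI allI impI C(1) p(1); elim conjE)
    fix s m u x
    assume s: "s \<in> K" and u: "0 \<le> Re (u * cis (-\<phi>))" and x: "x \<in> closed_segment (pt m) (pt m + u)"
    have "closed_segment (pt m) (pt m + u) \<subseteq> half_plane \<phi>"
      by (intro closed_segment_subset convex_half_plane half_plane_add_height[OF _ u]
          lattice_point_in_half_plane)
    then have "x \<in> half_plane \<phi>"
      using x by (rule subsetD)
    moreover have "cmod x \<ge> \<delta> * lattice_size {1..r} m"
      using segment_height[OF x u] \<delta>(2)[of m] by linarith
    ultimately show "cmod (log_power L x (g s)) \<le> C * lattice_size {1..r} m powr p"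
      using p s T lattice_size_ge_1 by (intro C(2)) auto
  qed
qed

lemma series_dominated:
  "lattice_dominated {1..r} (\<lambda>m s. log_power L (pt m) (- s)) {s. Re s > real r}"
  unfolding lattice_dominated_def
proof (intro allI impI, elim conjE)
  fix K assume K: "compact K" "K \<subseteq> {s. Re s > real r}"
  have holo: "uminus holomorphic_on (UNIV :: complex set)"
    by (intro holomorphic_intros)
  have Re: "\<forall>s\<in>K. Re (- s) < - real r"
    using K(2) by auto
  obtain C p where C: "C \<ge> 0" "p < - real r"
    "\<forall>s\<in>K. \<forall>m u x. 0 \<le> Re (u * cis (-\<phi>)) \<and> x \<in> closed_segment (pt m) (pt m + u)
       \<longrightarrow> cmod (log_power L x (- s)) \<le> C * lattice_size {1..r} m powr p"
    using log_power_dominated[OF K(1) holo Re] by (elim exE conjE)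
  have "\<forall>s\<in>K. \<forall>m\<in>{1..r} \<rightarrow>\<^sub>E UNIV. cmod (log_power L (pt m) (- s)) \<le> C * lattice_size {1..r} m powr p"
  proof (intro ballI)
    fix s m assume "s \<in> K"
    then show "cmod (log_power L (pt m) (- s)) \<le> C * lattice_size {1..r} m powr p"
      using C(3)[THEN bspec, of s, THEN spec, THEN spec, THEN spec, of 0 "pt m" m] by simp
  qed
  then show "\<exists>C p. p < - real (card {1..r}) \<and> (\<forall>s\<in>K. \<forall>m\<in>{1..r} \<rightarrow>\<^sub>E UNIV.
      cmod (log_power L (pt m) (- s)) \<le> C * lattice_size {1..r} m powr p)"
    using C(2) by auto
qed

text \<open>The remainder involves derivatives of order \<open>N + 1\<close>, hence powers with exponent
  \<open>r - s - N - 1\<close>. Its real part is below \<open>-r\<close> exactly in the stated half-plane, which grows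
  with \<open>N\<close>.\<close>

lemma remainder_dominated:
  "lattice_dominated {1..r} (remainder N) {s. Re s > 2 * real r - real N - 1}"
  unfolding lattice_dominated_def
proof (intro allI impI, elim conjE)
  fix K assume K: "compact K" "K \<subseteq> {s. Re s > 2 * real r - real N - 1}"
  define c where "c = (\<lambda>s. of_nat r - s :: complex)"
  have holo: "(\<lambda>s. c s - of_nat (Suc N)) holomorphic_on UNIV"
    unfolding c_def by (intro holomorphic_intros)
  have Re: "\<forall>s\<in>K. Re (c s - of_nat (Suc N)) < - real r"
    using K(2) by (auto simp: c_def)
  obtain C p where C: "C \<ge> 0" "p < - real r"
    "\<forall>s\<in>K. \<forall>m u x. 0 \<le> Re (u * cis (-\<phi>)) \<and> x \<in> closed_segment (pt m) (pt m + u)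
       \<longrightarrow> cmod (log_power L x (c s - of_nat (Suc N))) \<le> C * lattice_size {1..r} m powr p"
    using log_power_dominated[OF K(1) holo Re] by (elim exE conjE)
  have "continuous_on K (\<lambda>s. falling (c s) (Suc N))"
    unfolding c_def by (intro holomorphic_on_imp_continuous_on holomorphic_intros)
  then have "bounded ((\<lambda>s. falling (c s) (Suc N)) ` K)"
    by (intro compact_imp_bounded compact_continuous_image K(1))
  then obtain F where F': "\<forall>x\<in>(\<lambda>s. falling (c s) (Suc N)) ` K. cmod x \<le> F"
    unfolding bounded_iff by (elim exE)
  have F: "cmod (falling (c s) (Suc N)) \<le> F" if "s \<in> K" for s
    using bspec[OF F' imageI[OF that]] .
  define B where "B = (\<Sum>I\<in>Pow {1..r}. F * C * cmod (subset_sum I) ^ Suc N / fact N)"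
  have "cmod (remainder N m s) \<le> B * lattice_size {1..r} m powr p" if s: "s \<in> K" for m s
  proof -
    define T where "T = (\<lambda>u. \<Sum>l\<le>N. falling (c s) l / fact l * u ^ l * log_power L (pt m) (c s - of_nat l))"
    have "(\<Sum>l\<le>N. moment l * falling (c s) l / fact l * log_power L (pt m) (c s - of_nat l))
        = (\<Sum>I\<in>Pow {1..r}. (-1) ^ card I * T (subset_sum I))"
      unfolding T_def moment_def subset_sum_diff_def sum_distrib_left sum_distrib_right sum_divide_distrib
      by (subst sum.swap) (simp add: mult_ac)
    then have "remainder N m s
        = (\<Sum>I\<in>Pow {1..r}. (-1) ^ card I * (log_power L (pt m + subset_sum I) (c s) - T (subset_sum I)))"
      unfolding remainder_def c_def[symmetric]
      by (simp add: subset_sum_diff_def right_diff_distrib sum_subtractf)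
    also have "cmod \<dots> \<le> (\<Sum>I\<in>Pow {1..r}. F * C * cmod (subset_sum I) ^ Suc N / fact N
                                 * lattice_size {1..r} m powr p)"
    proof (rule sum_norm_le)
      fix I assume "I \<in> Pow {1..r}"
      then have h: "0 \<le> Re (subset_sum I * cis (-\<phi>))"
        by (intro subset_sum_height) simp
      have "cmod (log_power L (pt m + subset_sum I) (c s) - T (subset_sum I))
          \<le> cmod (falling (c s) (Suc N)) * (C * lattice_size {1..r} m powr p)
              * cmod (subset_sum I) ^ Suc N / fact N"
        unfolding T_def
      proof (rule log_power_Taylor[OF L open_half_plane convex_half_plane])
        show "pt m + subset_sum I \<in> half_plane \<phi>"
          by (rule half_plane_add_height[OF lattice_point_in_half_plane h])
        show "cmod (log_power L x (c s - of_nat (Suc N))) \<le> C * lattice_size {1..r} m powr p"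
          if "x \<in> closed_segment (pt m) (pt m + subset_sum I)" for x
          using C(3)[THEN bspec, OF s] h that by (simp only:)
      qed (rule lattice_point_in_half_plane)
      also have "\<dots> \<le> F * (C * lattice_size {1..r} m powr p) * cmod (subset_sum I) ^ Suc N / fact N"
        using C(1) F[OF s] by (intro divide_right_mono mult_right_mono) auto
      finally show "cmod ((-1) ^ card I * (log_power L (pt m + subset_sum I) (c s) - T (subset_sum I)))
          \<le> F * C * cmod (subset_sum I) ^ Suc N / fact N * lattice_size {1..r} m powr p"
        by (simp add: norm_mult norm_power mult_ac)
    qed
    also have "\<dots> = B * lattice_size {1..r} m powr p"
      by (simp add: B_def sum_distrib_right)
    finally show ?thesis .
  qed
  then show "\<exists>C p. p < - real (card {1..r}) \<and> (\<forall>s\<in>K. \<forall>m\<in>{1..r} \<rightarrow>\<^sub>E UNIV.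
      cmod (remainder N m s) \<le> C * lattice_size {1..r} m powr p)"
    using C(2) by (intro exI[of _ B] exI[of _ p] conjI ballI) auto
qed

lemma open_Re_gt: "open {s::complex. Re s > x}"
  by (simp add: open_halfspace_Re_gt)

lemma series_holomorphic: "barnes_series L r a w holomorphic_on {s. Re s > real r}"
  using lattice_dominated_holomorphic[OF series_dominated _ open_Re_gt]
  unfolding barnes_series_def[abs_def] by (simp add: holomorphic_intros)

definition remainder_sum :: "nat \<Rightarrow> complex \<Rightarrow> complex" where
  "remainder_sum N s = (\<Sum>\<^sub>\<infinity>m\<in>{1..r} \<rightarrow>\<^sub>E UNIV. remainder N m s)"

lemma remainder_sum_holomorphic:
  "remainder_sum N holomorphic_on {s. Re s > 2 * real r - real N - 1}"
  using lattice_dominated_holomorphic[OF remainder_dominated _ open_Re_gt remainder_holomorphic]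
  unfolding remainder_sum_def[abs_def] by simp

end
section \<open>The recurrence satisfied by the Barnes series\<close>

text \<open>The polynomial whose zeros are the possible poles \<open>1, \<dots>, r\<close> of the continued function.\<close>

definition pole_poly :: "nat \<Rightarrow> complex \<Rightarrow> complex" where
  "pole_poly r s = (\<Prod>j=1..r. s - of_nat j)"

lemma falling_add: "falling c (k + n) = falling c k * falling (c - of_nat k) n"
  by (induction n) (simp_all add: falling_def algebra_simps)

lemma falling_eq_pole_poly: "falling (of_nat r - s) r = (-1) ^ r * pole_poly r s"
proof -
  have "falling (of_nat r - s) r = (\<Prod>i<r. - (s - of_nat (r - i)))"
    unfolding falling_def by (intro prod.cong refl) (simp add: of_nat_diff)
  also have "\<dots> = (-1) ^ r * (\<Prod>i<r. s - of_nat (r - i))"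
    unfolding prod_uminus by simp
  also have "(\<Prod>i<r. s - of_nat (r - i)) = pole_poly r s"
    unfolding pole_poly_def
    by (rule prod.reindex_bij_witness[of _ "\<lambda>j. r - j" "\<lambda>i. r - i"]) auto
  finally show ?thesis .
qed

text \<open>The last \<open>r\<close> factors of the falling factorial cancel the poles of the Barnes function at the
  shifted argument \<open>s + k\<close>. This is why the recurrence below can be written for
  \<open>pole_poly * barnes_series\<close> without denominators.\<close>

lemma falling_shift_eq_pole_poly:
  "falling (of_nat r - s) (k + r) = falling (of_nat r - s) k * ((-1) ^ r * pole_poly r (s + of_nat k))"
proof -
  have "of_nat r - s - of_nat k = of_nat r - (s + of_nat k)"
    by simp
  then show ?thesis
    unfolding falling_add by (simp only: falling_eq_pole_poly)
qed

lemma pole_poly_holomorphic: "pole_poly r holomorphic_on U"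
  unfolding pole_poly_def[abs_def] by (intro holomorphic_intros)

context barnes_data
begin

lemma moment_eq_0: "l < r \<Longrightarrow> moment l = 0"
  unfolding moment_def by (subst subset_sum_diff_power) auto

lemma moment_r: "moment r = (-1) ^ r * fact r * (\<Prod>i=1..r. w i)"
  unfolding moment_def by (subst subset_sum_diff_power) auto

definition box_sum :: "nat \<Rightarrow> complex \<Rightarrow> complex" where
  "box_sum M s = (\<Sum>m\<in>{1..r} \<rightarrow>\<^sub>E {0..M}. log_power L (pt m) (- s))"

lemma box_sum_tendsto:
  "Re s > real r \<Longrightarrow> (\<lambda>M. box_sum M s) \<longlonglongrightarrow> barnes_series L r a w s"
  unfolding box_sum_def barnes_series_def
  by (rule lattice_dominated_box_tendsto[OF series_dominated]) simp_all

text \<open>The coefficients of the power series \<open>\<Prod>\<^sub>i (exp(w\<^sub>i X) - 1) / X\<close>.\<close>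

definition coef :: "nat \<Rightarrow> complex" where
  "coef k = (-1) ^ r * moment (k + r) / fact (k + r)"

lemma coef_0: "coef 0 = (\<Prod>i=1..r. w i)"
  by (simp add: coef_def moment_r flip: power_mult_distrib)

text \<open>The definition of the remainder, summed over a box: the alternating sums telescope to the
  corners, and the Taylor terms of order below \<open>r\<close> have vanishing moments.\<close>

lemma box_sum_remainder:
  "subset_sum_diff {1..r} (\<lambda>i. of_nat (M + 1) * w i) (\<lambda>x. log_power L x (of_nat r - s)) a
   = (\<Sum>k\<le>n. coef k * falling (of_nat r - s) k * (pole_poly r (s + of_nat k) * box_sum M (s + of_nat k)))
     + (\<Sum>m\<in>{1..r} \<rightarrow>\<^sub>E {0..M}. remainder (n + r) m s)"
proof -
  define c where "c = of_nat r - s"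
  define P where "P = (\<lambda>l. moment l * falling c l / fact l)"
  define S where "S = (\<lambda>l. \<Sum>m\<in>{1..r} \<rightarrow>\<^sub>E {0..M}. log_power L (pt m) (c - of_nat l))"
  have S: "S (k + r) = box_sum M (s + of_nat k)" for k
  proof -
    have "c - of_nat (k + r) = - (s + of_nat k)"
      by (simp add: c_def)
    then show ?thesis
      by (simp only: S_def box_sum_def)
  qed
  have "(\<Sum>m\<in>{1..r} \<rightarrow>\<^sub>E {0..M}. remainder (n + r) m s)
     = (\<Sum>m\<in>{1..r} \<rightarrow>\<^sub>E {0..M}. subset_sum_diff {1..r} w (\<lambda>x. log_power L x c) (pt m))
       - (\<Sum>m\<in>{1..r} \<rightarrow>\<^sub>E {0..M}. \<Sum>l\<le>n + r. P l * log_power L (pt m) (c - of_nat l))"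
    unfolding remainder_def c_def[symmetric] P_def sum_subtractf ..
  also have "(\<Sum>m\<in>{1..r} \<rightarrow>\<^sub>E {0..M}. subset_sum_diff {1..r} w (\<lambda>x. log_power L x c) (pt m))
     = subset_sum_diff {1..r} (\<lambda>i. of_nat (M + 1) * w i) (\<lambda>x. log_power L x c) a"
    unfolding lattice_point_def by (rule subset_sum_diff_telescope) simp
  also have "(\<Sum>m\<in>{1..r} \<rightarrow>\<^sub>E {0..M}. \<Sum>l\<le>n + r. P l * log_power L (pt m) (c - of_nat l))
     = (\<Sum>l\<le>n + r. P l * S l)"
    unfolding S_def sum_distrib_left by (rule sum.swap)
  also have "\<dots> = (\<Sum>l\<in>{r..n + r}. P l * S l)"
    by (rule sum.mono_neutral_right) (auto simp: P_def moment_eq_0)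
  also have "\<dots> = (\<Sum>k\<le>n. P (k + r) * S (k + r))"
    by (rule sum.reindex_bij_witness[of _ "\<lambda>k. k + r" "\<lambda>l. l - r"]) auto
  also have "\<dots> = (\<Sum>k\<le>n. coef k * falling c k * (pole_poly r (s + of_nat k) * box_sum M (s + of_nat k)))"
    unfolding S P_def coef_def c_def falling_shift_eq_pole_poly
    by (intro sum.cong refl) (simp only: times_divide_eq_left times_divide_eq_right mult_ac)
  finally show ?thesis
    unfolding c_def eq_diff_eq by (subst add.commute) (rule sym)
qed

lemma subset_multiple: "(\<Sum>i\<in>I. of_nat n * w i) = of_nat n * subset_sum I"
  by (simp add: sum_distrib_left)

lemma corner_in_half_plane: "I \<subseteq> {1..r} \<Longrightarrow> a + of_nat n * subset_sum I \<in> half_plane \<phi>"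
proof (rule half_plane_add_height[OF a])
  assume "I \<subseteq> {1..r}"
  then have "0 \<le> real n * Re (subset_sum I * cis (-\<phi>))"
    by (intro mult_nonneg_nonneg subset_sum_height) simp_all
  then show "0 \<le> Re (of_nat n * subset_sum I * cis (-\<phi>))"
    by (simp add: mult.assoc)
qed

text \<open>Corners other than \<open>a\<close> move off to infinity at linear speed. The bound covers the segment between
  corresponding corners of consecutive boxes, so that it serves both for the decay at a corner, the
  initial point of the segment, and for the difference between two consecutive corners.\<close>

lemma corner_power_bound:
  assumes I: "I \<subseteq> {1..r}" "I \<noteq> {}"
  shows "\<exists>C\<ge>0. \<forall>s p. \<forall>n\<ge>1. \<forall>x\<in>closed_segment (a + of_nat n * subset_sum I)
                                     (a + of_nat n * subset_sum I + subset_sum I).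
           cmod s \<le> T \<and> Re s \<le> p \<and> p \<le> 0 \<longrightarrow> cmod (log_power L x s) \<le> C * real n powr p"
proof -
  define u where "u = subset_sum I"
  define \<delta> where "\<delta> = Re (u * cis (-\<phi>))"
  have \<delta>: "\<delta> > 0"
    using subset_sum_in_half_plane[OF I] unfolding half_plane_iff \<delta>_def u_def .
  obtain C where C: "C \<ge> 0"
    "\<And>z s x p. \<lbrakk>z \<in> half_plane \<phi>; cmod z \<ge> \<delta> * x; x \<ge> 1; cmod s \<le> T; Re s \<le> p; p \<le> 0\<rbrakk>
        \<Longrightarrow> cmod (log_power L z s) \<le> C * x powr p"
    using log_power_bound[OF L \<delta>] by metis
  have "cmod (log_power L x s) \<le> C * real n powr p"
    if n: "n \<ge> 1" and x: "x \<in> closed_segment (a + of_nat n * u) (a + of_nat n * u + u)"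
      and s: "cmod s \<le> T" "Re s \<le> p" "p \<le> 0" for s p x n
  proof -
    have 0: "a + of_nat n * u \<in> half_plane \<phi>"
      unfolding u_def by (rule corner_in_half_plane[OF I(1)])
    have u: "0 \<le> Re (u * cis (-\<phi>))"
      using \<delta> by (simp add: \<delta>_def)
    have "closed_segment (a + of_nat n * u) (a + of_nat n * u + u) \<subseteq> half_plane \<phi>"
      by (intro closed_segment_subset convex_half_plane half_plane_add_height[OF _ u] 0)
    then have "x \<in> half_plane \<phi>"
      using x by (rule subsetD)
    moreover have "\<delta> * real n \<le> cmod x"
    proof -
      have "Re ((a + of_nat n * u) * cis (-\<phi>)) = Re (a * cis (-\<phi>)) + real n * \<delta>"
        by (simp add: \<delta>_def distrib_right mult.assoc right_diff_distrib distrib_left)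
      moreover have "Re (a * cis (-\<phi>)) > 0"
        using a unfolding half_plane_iff .
      ultimately show ?thesis
        using segment_height[OF x u] by (simp only: mult.commute)
    qed
    ultimately show ?thesis
      using n s by (intro C(2)) simp_all
  qed
  then show ?thesis
    unfolding u_def using C(1) by (intro exI[of _ C] conjI allI ballI impI) simp_all
qed

lemma corner_power_tendsto_0:
  assumes I: "I \<subseteq> {1..r}" "I \<noteq> {}" and s: "Re s < 0"
  shows "(\<lambda>M. log_power L (a + of_nat (M + 1) * subset_sum I) s) \<longlonglongrightarrow> 0"
proof -
  obtain C where C: "C \<ge> 0" "\<forall>t p. \<forall>n\<ge>1. \<forall>x\<in>closed_segment (a + of_nat n * subset_sum I)
                                     (a + of_nat n * subset_sum I + subset_sum I).
           cmod t \<le> cmod s \<and> Re t \<le> p \<and> p \<le> 0 \<longrightarrow> cmod (log_power L x t) \<le> C * real n powr p"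
    using corner_power_bound[OF I, of "cmod s"] by (elim exE conjE)
  have "cmod (log_power L (a + of_nat (M + 1) * subset_sum I) s) \<le> C * real (M + 1) powr Re s" for M
    using C(2)[THEN spec, THEN spec, THEN spec, THEN mp, THEN bspec, THEN mp,
        of "M + 1" "a + of_nat (M + 1) * subset_sum I" s "Re s"] s by simp
  then have bound: "\<forall>\<^sub>F M in sequentially. cmod (log_power L (a + of_nat (M + 1) * subset_sum I) s)
      \<le> C * real (M + 1) powr Re s"
    by (intro always_eventually allI)
  have lim: "(\<lambda>M. C * real (M + 1) powr Re s) \<longlonglongrightarrow> 0"
  proof -
    have "(\<lambda>M. real (M + 1) powr Re s) \<longlonglongrightarrow> 0"
      by (rule tendsto_neg_powr[OF s])
         (rule filterlim_compose[OF filterlim_real_sequentially filterlim_add_const_nat_at_top])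
    then show ?thesis
      by (rule tendsto_mult_right_zero)
  qed
  show ?thesis
    by (rule Lim_null_comparison[OF bound lim])
qed

text \<open>The limit of the box identity: for \<open>Re s > r\<close> every corner except \<open>a\<close> contributes a power that
  tends to zero.\<close>

lemma series_recurrence:
  assumes s: "Re s > real r"
  shows "log_power L a (of_nat r - s)
    = (\<Sum>k\<le>n. coef k * falling (of_nat r - s) k
          * (pole_poly r (s + of_nat k) * barnes_series L r a w (s + of_nat k)))
      + remainder_sum (n + r) s"
proof (rule LIMSEQ_unique)
  let ?D = "\<lambda>M. subset_sum_diff {1..r} (\<lambda>i. of_nat (M + 1) * w i) (\<lambda>x. log_power L x (of_nat r - s)) a"
  have "?D M = log_power L a (of_nat r - s) + (\<Sum>I\<in>Pow {1..r} - {{}}.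
           (-1) ^ card I * log_power L (a + of_nat (M + 1) * subset_sum I) (of_nat r - s))" for M
    unfolding subset_sum_diff_def subset_multiple by (subst sum.remove[of _ "{}"]) auto
  moreover have "(\<lambda>M. log_power L a (of_nat r - s) + (\<Sum>I\<in>Pow {1..r} - {{}}.
           (-1) ^ card I * log_power L (a + of_nat (M + 1) * subset_sum I) (of_nat r - s)))
        \<longlonglongrightarrow> log_power L a (of_nat r - s) + (\<Sum>I\<in>Pow {1..r} - {{}}. (-1) ^ card I * 0)"
    using s by (intro tendsto_intros corner_power_tendsto_0) auto
  ultimately show "?D \<longlonglongrightarrow> log_power L a (of_nat r - s)"
    by simp
  have "(\<lambda>M. \<Sum>m\<in>{1..r} \<rightarrow>\<^sub>E {0..M}. remainder (n + r) m s) \<longlonglongrightarrow> remainder_sum (n + r) s"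
    unfolding remainder_sum_def
    by (rule lattice_dominated_box_tendsto[OF remainder_dominated]) (use s in simp_all)
  then show "?D \<longlonglongrightarrow> (\<Sum>k\<le>n. coef k * falling (of_nat r - s) k
          * (pole_poly r (s + of_nat k) * barnes_series L r a w (s + of_nat k)))
      + remainder_sum (n + r) s"
    unfolding box_sum_remainder[where n = n]
    by (intro tendsto_intros box_sum_tendsto) (use s in simp_all)
qed

end
section \<open>Analytic continuation\<close>

text \<open>By the identity theorem the two functions agree near every point, except possibly at the
  point itself. The normalisation of nicely meromorphic functions fixes the remaining value: it is
  the limit, or zero at a pole.\<close>

lemma nicely_meromorphic_on_eqI:
  assumes f: "f nicely_meromorphic_on A" and g: "g nicely_meromorphic_on A"
    and A: "open A" "connected A" and z0: "z0 \<in> A" "\<forall>\<^sub>F z in at z0. f z = g z" and z: "z \<in> A"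
  shows "f z = g z"
proof -
  have "(\<lambda>z. f z - g z) meromorphic_on A"
    using f g unfolding nicely_meromorphic_on_def by (intro meromorphic_intros) auto
  then have "(\<forall>\<^sub>\<approx>z\<in>A. f z - g z = 0) \<or> (\<forall>\<^sub>\<approx>z\<in>A. f z - g z \<noteq> 0)"
    using A by (rule meromorphic_imp_constant_or_avoid)
  moreover have "\<not> (\<forall>\<^sub>\<approx>z\<in>A. f z - g z \<noteq> 0)"
  proof
    assume "\<forall>\<^sub>\<approx>z\<in>A. f z - g z \<noteq> 0"
    then have "\<forall>\<^sub>F z in at z0. f z - g z \<noteq> 0"
      using A(1) z0(1) by (simp add: eventually_cosparse_open_eq)
    with z0(2) have "\<forall>\<^sub>F z in at z0. False"
      by eventually_elim simp
    then show False
      by simp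
  qed
  ultimately have "\<forall>\<^sub>\<approx>z\<in>A. f z - g z = 0"
    by blast
  then have "\<forall>\<^sub>F x in at z. f x - g x = 0"
    using A(1) z by (simp add: eventually_cosparse_open_eq)
  then have ev: "\<forall>\<^sub>F x in at z. f x = g x"
    by (rule eventually_mono) simp
  have fz: "(is_pole f z \<and> f z = 0) \<or> f \<midarrow>z\<rightarrow> f z" and gz: "(is_pole g z \<and> g z = 0) \<or> g \<midarrow>z\<rightarrow> g z"
    using f g z unfolding nicely_meromorphic_on_def by blast+
  have pole: "is_pole f z \<longleftrightarrow> is_pole g z"
    by (rule is_pole_cong[OF ev refl])
  show ?thesis
  proof (cases "is_pole f z")
    case True
    then have "\<not> f \<midarrow>z\<rightarrow> f z" "\<not> g \<midarrow>z\<rightarrow> g z"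
      using pole unfolding is_pole_def by (meson not_tendsto_and_filterlim_at_infinity trivial_limit_at)+
    then show ?thesis
      using fz gz by simp
  next
    case False
    then have "f \<midarrow>z\<rightarrow> f z" "g \<midarrow>z\<rightarrow> g z"
      using fz gz pole by blast+
    moreover have "f \<midarrow>z\<rightarrow> g z"
      using \<open>g \<midarrow>z\<rightarrow> g z\<close> tendsto_cong[OF ev] by blast
    ultimately show ?thesis
      using LIM_unique by blast
  qed
qed

lemma pole_poly_nonzero: "Re s > real r \<Longrightarrow> pole_poly r s \<noteq> 0"
proof -
  assume "Re s > real r"
  then have "s - of_nat j \<noteq> 0" if "j \<in> {1..r}" for j
    using that by auto
  then show ?thesis
    unfolding pole_poly_def by (subst prod_zero_iff) auto
qed

context barnes_data
begin

lemma prod_w_nonzero: "(\<Prod>i=1..r. w i) \<noteq> 0"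
  using half_plane_nonzero[OF w] by (subst prod_zero_iff) auto

abbreviation entire_zeta :: "complex \<Rightarrow> complex" where
  "entire_zeta s \<equiv> pole_poly r s * barnes_series L r a w s"

text \<open>The recurrence expresses the function at \<open>s\<close> by its values at \<open>s + 1, \<dots>, s + n\<close>, an elementary
  term and a remainder sum that is holomorphic for \<open>Re s > r - n - 1\<close>. Each application
  therefore extends the half-plane of holomorphy by one to the left.\<close>

lemma continuation_strip:
  "\<exists>g. g holomorphic_on {s. Re s > real r - real n} \<and> (\<forall>s. Re s > real r \<longrightarrow> g s = entire_zeta s)"
proof (induction n)
  case 0
  have "entire_zeta holomorphic_on {s. Re s > real r}"
    by (intro holomorphic_intros pole_poly_holomorphic series_holomorphic)
  then show ?case
    by (intro exI[of _ entire_zeta] conjI) simp_all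
next
  case (Suc n)
  then obtain g where g: "g holomorphic_on {s. Re s > real r - real n}"
    "\<forall>s. Re s > real r \<longrightarrow> g s = entire_zeta s"
    by (elim exE conjE)
  define U where "U = {s. Re s > real r - real (Suc n)}"
  define R where "R = (\<lambda>s. \<Sum>k\<in>{1..n}. coef k * falling (of_nat r - s) k * g (s + of_nat k))"
  define g' where "g' = (\<lambda>s. (log_power L a (of_nat r - s) - R s - remainder_sum (n + r) s)
                              / (\<Prod>i=1..r. w i))"
  have shift: "(\<lambda>s. g (s + of_nat k)) holomorphic_on U" if "k \<in> {1..n}" for k
  proof -
    have "(g \<circ> (\<lambda>s. s + of_nat k)) holomorphic_on U"
    proof (rule holomorphic_on_compose_gen[OF _ g(1)])
      show "(\<lambda>s. s + of_nat k) ` U \<subseteq> {s. Re s > real r - real n}"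
        using that by (auto simp: U_def)
    qed (intro holomorphic_intros)
    then show ?thesis
      by (simp only: o_def)
  qed
  have "remainder_sum (n + r) holomorphic_on U"
    using remainder_sum_holomorphic[of "n + r"] by (rule holomorphic_on_subset) (auto simp: U_def)
  then have "g' holomorphic_on U"
    unfolding g'_def R_def by (intro holomorphic_intros shift prod_w_nonzero)
  moreover have "g' s = entire_zeta s" if s: "Re s > real r" for s
  proof -
    have "log_power L a (of_nat r - s)
        = (\<Sum>k\<in>insert 0 {1..n}. coef k * falling (of_nat r - s) k * entire_zeta (s + of_nat k))
          + remainder_sum (n + r) s"
      unfolding series_recurrence[OF s, of n] by (intro arg_cong2[of _ _ _ _ "(+)"] sum.cong) auto
    also have "(\<Sum>k\<in>insert 0 {1..n}. coef k * falling (of_nat r - s) k * entire_zeta (s + of_nat k))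
        = coef 0 * entire_zeta s
          + (\<Sum>k\<in>{1..n}. coef k * falling (of_nat r - s) k * entire_zeta (s + of_nat k))"
      by (subst sum.insert) (simp_all add: falling_def)
    also have "(\<Sum>k\<in>{1..n}. coef k * falling (of_nat r - s) k * entire_zeta (s + of_nat k)) = R s"
      unfolding R_def using s g(2) by (intro sum.cong refl arg_cong2[of _ _ _ _ "(*)"]) simp
    finally have "log_power L a (of_nat r - s) - R s - remainder_sum (n + r) s = coef 0 * entire_zeta s"
      by simp
    then show ?thesis
      unfolding g'_def coef_0 using prod_w_nonzero by simp
  qed
  ultimately show ?case
    unfolding U_def by (intro exI[of _ g'] conjI allI impI)
qed

lemma half_plane_Re_identity:
  assumes "f holomorphic_on {s. Re s > x}" "g holomorphic_on {s. Re s > x}" "x \<le> y"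
    and "\<And>s. Re s > y \<Longrightarrow> f s = g s" and "Re z > x"
  shows "f z = g z"
proof (rule analytic_continuation_open[of "{s. Re s > y}" "{s. Re s > x}" f g])
  have "complex_of_real (y + 1) \<in> {s. Re s > y}"
    by simp
  then show "{s. Re s > y} \<noteq> {}"
    by blast
  show "connected {s. Re s > x}"
    by (intro convex_connected convex_halfspace_Re_gt)
qed (use assms open_Re_gt in auto)

theorem continuation:
  "\<exists>h. h holomorphic_on UNIV \<and> (\<forall>s. Re s > real r \<longrightarrow> h s = entire_zeta s)"
proof -
  obtain G where G: "\<And>n. G n holomorphic_on {s. Re s > real r - real n}"
    "\<And>n s. Re s > real r \<Longrightarrow> G n s = entire_zeta s"
    using continuation_strip by metis
  have eq: "G n s = G k s" if "Re s > real r - real n" "Re s > real r - real k" for n k s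
  proof -
    define x where "x = max (real r - real n) (real r - real k)"
    have "G n holomorphic_on {s. Re s > x}" "G k holomorphic_on {s. Re s > x}"
      by (rule holomorphic_on_subset[OF G(1)]; auto simp: x_def)+
    moreover have "x \<le> real r"
      by (simp add: x_def)
    ultimately show ?thesis
      by (rule half_plane_Re_identity) (use G(2) that in \<open>simp_all add: x_def\<close>)
  qed
  define h where "h = (\<lambda>s. G (nat \<lceil>real r - Re s\<rceil> + 1) s)"
  have h: "h s = G n s" if "Re s > real r - real n" for n s
  proof -
    have "Re s > real r - real (nat \<lceil>real r - Re s\<rceil> + 1)"
      by linarith
    then show ?thesis
      unfolding h_def using that by (rule eq)
  qed
  have "h holomorphic_on (\<Union>n\<in>UNIV. {s. Re s > real r - real n})"
  proof (rule holomorphic_on_UN_open)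
    show "h holomorphic_on {s. Re s > real r - real n}" for n
      by (rule holomorphic_transform[OF G(1)[of n]]) (simp add: h)
  qed (rule open_Re_gt)
  moreover have "(\<Union>n\<in>UNIV. {s. Re s > real r - real n}) = UNIV"
  proof (intro equalityI subsetI UNIV_I)
    fix s :: complex
    obtain n :: nat where "real r - Re s < real n"
      using reals_Archimedean2 by blast
    then show "s \<in> (\<Union>n\<in>UNIV. {s. Re s > real r - real n})"
      by (intro UN_I[of n]) simp_all
  qed
  moreover have "h s = entire_zeta s" if "Re s > real r" for s
    using h[of 0 s] G(2) that by simp
  ultimately show ?thesis
    by (intro exI[of _ h]) simp
qed

lemma barnes_zeta_eq:
  assumes h: "h holomorphic_on UNIV" "\<And>s. Re s > real r \<Longrightarrow> h s = entire_zeta s"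
  shows "barnes_zeta L r a w = remove_sings (\<lambda>s. h s / pole_poly r s)"
proof -
  define f where "f = (\<lambda>s. h s / pole_poly r s)"
  have "h analytic_on UNIV" "pole_poly r analytic_on UNIV"
    using h(1) pole_poly_holomorphic by (simp_all add: analytic_on_open)
  then have "f meromorphic_on UNIV"
    unfolding f_def by (intro meromorphic_intros analytic_on_imp_meromorphic_on)
  then have nice: "remove_sings f nicely_meromorphic_on UNIV"
    by (rule remove_sings_nicely_meromorphic)
  have series: "remove_sings f s = barnes_series L r a w s" if s: "Re s > real r" for s
  proof -
    have "f holomorphic_on {s. Re s > real r}"
      unfolding f_def using pole_poly_nonzero
      by (intro holomorphic_intros pole_poly_holomorphic holomorphic_on_subset[OF h(1)]) auto
    then have "f analytic_on {s}"
      using s open_Re_gt by (intro holomorphic_on_imp_analytic_at[of _ "{s. Re s > real r}"]) auto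
    then have "remove_sings f s = f s"
      by (rule remove_sings_at_analytic)
    then show ?thesis
      using s h(2) pole_poly_nonzero[OF s] by (simp add: f_def)
  qed
  show ?thesis
    unfolding barnes_zeta_def f_def[symmetric]
  proof (rule the_equality)
    show "remove_sings f nicely_meromorphic_on UNIV \<and>
        (\<forall>s. Re s > real r \<longrightarrow> remove_sings f s = barnes_series L r a w s)"
      using nice series by blast
  next
    fix g assume g: "g nicely_meromorphic_on UNIV \<and>
        (\<forall>s. Re s > real r \<longrightarrow> g s = barnes_series L r a w s)"
    define z0 where "z0 = complex_of_real (real r + 1)"
    have "\<forall>\<^sub>F s in nhds z0. s \<in> {s. Re s > real r}"
      by (rule eventually_nhds_in_open[OF open_Re_gt]) (simp add: z0_def)
    then have "\<forall>\<^sub>F s in nhds z0. g s = remove_sings f s"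
      by (rule eventually_mono) (use g series in simp)
    then have "\<forall>\<^sub>F s in at z0. g s = remove_sings f s"
      unfolding eventually_at_filter by (rule eventually_mono) simp
    then show "g = remove_sings f"
      by (intro ext nicely_meromorphic_on_eqI[OF conjunct1[OF g] nice open_UNIV connected_UNIV UNIV_I _ UNIV_I])
  qed
qed

end
section \<open>Laurent coefficients at the rightmost pole\<close>

lemma uniform_limit_sum:
  fixes f :: "'i \<Rightarrow> 'n \<Rightarrow> 'x \<Rightarrow> 'b::real_normed_vector"
  assumes "\<And>i. i \<in> I \<Longrightarrow> uniform_limit X (f i) (l i) F"
  shows "uniform_limit X (\<lambda>n x. \<Sum>i\<in>I. f i n x) (\<lambda>x. \<Sum>i\<in>I. l i x) F"
  using assms
proof (induction I rule: infinite_finite_induct)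
  case (insert i I)
  have "uniform_limit X (\<lambda>n x. f i n x + (\<Sum>i\<in>I. f i n x)) (\<lambda>x. l i x + (\<Sum>i\<in>I. l i x)) F"
    by (intro uniform_limit_add insert.IH insert.prems) simp_all
  then show ?case
    using insert.hyps by simp
qed (simp_all add: uniform_limit_const)

text \<open>What is left of \<open>pole_poly\<close> at \<open>r + \<epsilon>\<close> when the factor \<open>\<epsilon>\<close> is removed; its reciprocal
  is the generating function of the constants \<open>c\<^sub>q\<close>.\<close>

definition pole_cofactor :: "nat \<Rightarrow> complex \<Rightarrow> complex" where
  "pole_cofactor r \<epsilon> = (\<Prod>j=1..r - 1. of_nat j + \<epsilon>)"

lemma pole_poly_at_pole:
  assumes "r \<ge> 1"
  shows "pole_poly r (of_nat r + \<epsilon>) = \<epsilon> * pole_cofactor r \<epsilon>"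
proof -
  have "pole_poly r (of_nat r + \<epsilon>) = (\<Prod>j\<in>insert r {1..r - 1}. of_nat r + \<epsilon> - of_nat j)"
    unfolding pole_poly_def by (rule prod.cong) (use assms in auto)
  also have "\<dots> = \<epsilon> * (\<Prod>j=1..r - 1. of_nat r + \<epsilon> - of_nat j)"
    using assms by (subst prod.insert) auto
  also have "(\<Prod>j=1..r - 1. of_nat r + \<epsilon> - of_nat j) = pole_cofactor r \<epsilon>"
    unfolding pole_cofactor_def
    by (rule prod.reindex_bij_witness[of _ "\<lambda>j. r - j" "\<lambda>j. r - j"]) (auto simp: of_nat_diff)
  finally show ?thesis .
qed

lemma pole_cofactor_nonzero:
  assumes "cmod \<epsilon> < 1"
  shows "pole_cofactor r \<epsilon> \<noteq> 0"
proof -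
  have "of_nat j + \<epsilon> \<noteq> 0" if "j \<in> {1..r - 1}" for j
  proof
    assume "of_nat j + \<epsilon> = 0"
    then have "\<epsilon> = - of_nat j"
      by (simp add: eq_neg_iff_add_eq_0 add.commute)
    then have "cmod \<epsilon> = real j"
      by simp
    then show False
      using that assms by simp
  qed
  then show ?thesis
    unfolding pole_cofactor_def by (subst prod_zero_iff) auto
qed

definition pole_cofactor_fps :: "nat \<Rightarrow> complex fps" where
  "pole_cofactor_fps r = (\<Prod>j=1..r - 1. of_nat j + fps_X)"

lemma has_fps_expansion_pole_cofactor:
  "pole_cofactor r has_fps_expansion pole_cofactor_fps r"
  unfolding pole_cofactor_def[abs_def] pole_cofactor_fps_def fps_of_nat[symmetric]
  by (intro fps_expansion_intros)

lemma pole_cofactor_fps_nth_0: "pole_cofactor_fps r $ 0 = fact (r - 1)"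
proof -
  have "(\<Prod>j=1..n. of_nat j + fps_X :: complex fps) $ 0 = fact n" for n
    by (induction n) (simp_all add: fps_mult_nth algebra_simps)
  then show ?thesis
    by (simp add: pole_cofactor_fps_def)
qed

lemma pole_cofactor_fps_nth_1: "pole_cofactor_fps r $ 1 = fact (r - 1) * harm (r - 1)"
proof -
  have 0: "(\<Prod>j=1..n. of_nat j + fps_X :: complex fps) $ 0 = fact n" for n
    by (induction n) (simp_all add: fps_mult_nth algebra_simps)
  have "(\<Prod>j=1..n. of_nat j + fps_X :: complex fps) $ 1 = fact n * harm n" for n
  proof (induction n)
    case (Suc n)
    have "(\<Prod>j=1..Suc n. of_nat j + fps_X :: complex fps) $ 1
        = fact n * harm n * of_nat (Suc n) + fact n"
      using Suc 0[of n] by (simp add: fps_mult_nth)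
    also have "\<dots> = fact (Suc n) * harm (Suc n)"
      by (simp add: harm_Suc field_simps del: of_nat_Suc)
    finally show ?case .
  qed (simp add: harm_def)
  then show ?thesis
    by (simp only: pole_cofactor_fps_def)
qed

lemma reciprocal_coefficients:
  assumes c: "\<And>\<epsilon>::complex. norm \<epsilon> < 1 \<Longrightarrow>
              (\<lambda>q. c q * \<epsilon> ^ q) sums (1 / (\<Prod>j = 1..r - 1. (of_nat j + \<epsilon>)))"
  shows "(\<lambda>\<epsilon>. 1 / pole_cofactor r \<epsilon>) has_fps_expansion Abs_fps c"
    and "Abs_fps c * pole_cofactor_fps r = 1"
proof -
  have ball: "\<forall>\<^sub>F \<epsilon> in nhds 0. \<epsilon> \<in> ball (0::complex) 1"
    by (rule eventually_nhds_in_open) simp_all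
  show *: "(\<lambda>\<epsilon>. 1 / pole_cofactor r \<epsilon>) has_fps_expansion Abs_fps c"
    by (rule has_fps_expansionI, rule eventually_mono[OF ball])
       (use c in \<open>simp add: pole_cofactor_def\<close>)
  have "(\<lambda>\<epsilon>. 1 / pole_cofactor r \<epsilon> * pole_cofactor r \<epsilon>)
      has_fps_expansion (Abs_fps c * pole_cofactor_fps r)"
    by (intro has_fps_expansion_mult * has_fps_expansion_pole_cofactor)
  moreover have "\<forall>\<^sub>F \<epsilon> in nhds 0. 1 / pole_cofactor r \<epsilon> * pole_cofactor r \<epsilon> = 1"
    by (rule eventually_mono[OF ball]) (use pole_cofactor_nonzero in simp)
  ultimately have "(\<lambda>\<epsilon>. 1) has_fps_expansion (Abs_fps c * pole_cofactor_fps r)"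
    by (simp only: has_fps_expansion_cong[OF _ refl])
  then show "Abs_fps c * pole_cofactor_fps r = 1"
    using fps_expansion_eqI has_fps_expansion_1 by metis
qed

context barnes_data
begin

text \<open>The contribution of the corners other than \<open>a\<close>, at \<open>s = r + \<epsilon>\<close>.\<close>

definition corner_sum :: "nat \<Rightarrow> complex \<Rightarrow> complex" where
  "corner_sum n \<epsilon> = (\<Sum>I\<in>Pow {1..r} - {{}}.
     (-1) ^ card I * log_power L (a + of_nat n * subset_sum I) (- \<epsilon>))"

text \<open>Telescoping over the box \<open>{0..M}\<close> produces the corners of side \<open>M + 1\<close>, whereas the limit formula
  has those of side \<open>M\<close>. The derivative of \<open>x \<mapsto> x\<^sup>-\<^sup>\<epsilon>\<close> is of order \<open>M\<^sup>-\<^sup>1\<^sup>/\<^sup>2\<close> or less on the segment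
  between them when \<open>\<bar>\<epsilon>\<bar> < 1/2\<close>, so the discrepancy vanishes in the limit.\<close>

lemma corner_shift:
  assumes I: "I \<subseteq> {1..r}" "I \<noteq> {}"
  shows "uniform_limit (ball 0 (1/2)) (\<lambda>M \<epsilon>.
      log_power L (a + of_nat (M + 1) * subset_sum I) (- \<epsilon>)
      - log_power L (a + of_nat M * subset_sum I) (- \<epsilon>)) (\<lambda>\<epsilon>. 0) sequentially"
proof -
  define u where "u = subset_sum I"
  obtain C where C: "C \<ge> 0" "\<forall>s p. \<forall>n\<ge>1. \<forall>x\<in>closed_segment (a + of_nat n * u) (a + of_nat n * u + u).
           cmod s \<le> 2 \<and> Re s \<le> p \<and> p \<le> 0 \<longrightarrow> cmod (log_power L x s) \<le> C * real n powr p"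
    using corner_power_bound[OF I, of 2] unfolding u_def by (elim exE conjE)
  have bound: "cmod (log_power L (a + of_nat (M + 1) * u) (- \<epsilon>) - log_power L (a + of_nat M * u) (- \<epsilon>))
      \<le> C * cmod u * real M powr (-1/2)" if M: "M \<ge> 1" and e: "\<epsilon> \<in> ball 0 (1/2)" for M \<epsilon>
  proof -
    have Re: "\<bar>Re \<epsilon>\<bar> < 1/2" "cmod \<epsilon> < 1/2"
      using e abs_Re_le_cmod[of \<epsilon>] by simp_all
    have n1: "cmod (- \<epsilon> - of_nat (Suc 0)) \<le> 2"
      using norm_triangle_ineq4[of "- \<epsilon>" 1] Re by simp
    have step: "a + of_nat (M + 1) * u = a + of_nat M * u + u"
      by (simp add: algebra_simps)
    have "cmod (log_power L (a + of_nat M * u + u) (- \<epsilon>)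
             - (\<Sum>l\<le>0. falling (- \<epsilon>) l / fact l * u ^ l * log_power L (a + of_nat M * u) (- \<epsilon> - of_nat l)))
        \<le> cmod (falling (- \<epsilon>) (Suc 0)) * (C * real M powr (-1/2)) * cmod u ^ Suc 0 / fact 0"
    proof (rule log_power_Taylor[OF L open_half_plane convex_half_plane])
      show "a + of_nat M * u \<in> half_plane \<phi>"
        unfolding u_def by (rule corner_in_half_plane[OF I(1)])
      show "a + of_nat M * u + u \<in> half_plane \<phi>"
        unfolding step[symmetric] unfolding u_def by (rule corner_in_half_plane[OF I(1)])
      fix x assume x: "x \<in> closed_segment (a + of_nat M * u) (a + of_nat M * u + u)"
      show "cmod (log_power L x (- \<epsilon> - of_nat (Suc 0))) \<le> C * real M powr (-1/2)"
        using C(2)[THEN spec, THEN spec, THEN spec, THEN mp, THEN bspec, THEN mp, OF M x,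
            of "- \<epsilon> - of_nat (Suc 0)" "-1/2"] n1 Re by simp
    qed
    also have "\<dots> = cmod \<epsilon> * (C * cmod u * real M powr (-1/2))"
      by (simp add: falling_def)
    also have "\<dots> \<le> 1 * (C * cmod u * real M powr (-1/2))"
      using Re C(1) by (intro mult_right_mono) auto
    finally show ?thesis
      unfolding step by (simp add: falling_def)
  qed
  have ev: "\<forall>\<^sub>F M in sequentially. \<forall>\<epsilon>\<in>ball 0 (1/2).
      norm (log_power L (a + of_nat (M + 1) * subset_sum I) (- \<epsilon>)
      - log_power L (a + of_nat M * subset_sum I) (- \<epsilon>)) \<le> C * cmod u * real M powr (-1/2)"
    using eventually_ge_at_top[of 1] by eventually_elim (use bound u_def in simp)
  have "(\<lambda>M. real M powr (-1/2)) \<longlonglongrightarrow> 0"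
    by (rule tendsto_neg_powr[OF _ filterlim_real_sequentially]) simp
  then have "(\<lambda>M. C * cmod u * real M powr (-1/2)) \<longlonglongrightarrow> 0"
    by (rule tendsto_mult_right_zero)
  then have "uniform_limit (ball 0 (1/2)) (\<lambda>M \<epsilon>. C * cmod u * real M powr (-1/2)) (\<lambda>\<epsilon>. 0) sequentially"
    unfolding uniform_limit_iff tendsto_iff by (auto elim!: eventually_mono)
  with ev show ?thesis
    by (rule uniform_limit_null_comparison)
qed

lemma corner_sum_shift:
  "uniform_limit (ball 0 (1/2)) (\<lambda>M \<epsilon>. corner_sum (M + 1) \<epsilon> - corner_sum M \<epsilon>) (\<lambda>\<epsilon>. 0) sequentially"
proof -
  have "uniform_limit (ball 0 (1/2)) (\<lambda>M \<epsilon>. \<Sum>I\<in>Pow {1..r} - {{}}. (-1) ^ card I *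
      (log_power L (a + of_nat (M + 1) * subset_sum I) (- \<epsilon>)
      - log_power L (a + of_nat M * subset_sum I) (- \<epsilon>))) (\<lambda>\<epsilon>. \<Sum>I\<in>Pow {1..r} - {{}}. (-1) ^ card I * 0)
      sequentially"
    by (intro uniform_limit_sum bounded_linear.uniform_limit[OF bounded_linear_mult_right] corner_shift) auto
  then show ?thesis
    by (simp only: corner_sum_def right_diff_distrib sum_subtractf mult_zero_right sum.neutral_const)
qed

text \<open>The recurrence with \<open>n = 0\<close>, continued analytically to \<open>Re s > r - 1\<close>, where the remainder sum still
  converges.\<close>

lemma entire_zeta_remainder:
  assumes h: "h holomorphic_on UNIV" "\<And>s. Re s > real r \<Longrightarrow> h s = entire_zeta s"
    and s: "Re s > real r - 1"
  shows "(\<Prod>i=1..r. w i) * h s = log_power L a (of_nat r - s) - remainder_sum r s"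
proof (rule half_plane_Re_identity[where x = "real r - 1" and y = "real r" and z = s
      and f = "\<lambda>s. (\<Prod>i=1..r. w i) * h s"
      and g = "\<lambda>s. log_power L a (of_nat r - s) - remainder_sum r s"])
  show "(\<lambda>s. (\<Prod>i=1..r. w i) * h s) holomorphic_on {s. Re s > real r - 1}"
    by (intro holomorphic_intros holomorphic_on_subset[OF h(1)]) simp
  have "remainder_sum r holomorphic_on {s. Re s > real r - 1}"
    using remainder_sum_holomorphic[of r] by (rule holomorphic_on_subset) auto
  then show "(\<lambda>s. log_power L a (of_nat r - s) - remainder_sum r s) holomorphic_on {s. Re s > real r - 1}"
    by (intro holomorphic_intros)
  show "(\<Prod>i=1..r. w i) * h s = log_power L a (of_nat r - s) - remainder_sum r s" if "Re s > real r" for s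
    using series_recurrence[OF that, of 0] h(2)[OF that] coef_0 by (simp add: falling_def)
qed (use s in simp_all)

text \<open>By the box identity, the approximating function differs from the box sum of the negated remainders
  only by the term at \<open>a\<close> and the shift of the corners from side \<open>M + 1\<close> to \<open>M\<close>. The remainders are
  summable on both sides of the line \<open>Re s = r\<close>, which the terms of the Barnes series are not.\<close>

lemma numerator_uniform_limit:
  assumes h: "h holomorphic_on UNIV" "\<And>s. Re s > real r \<Longrightarrow> h s = entire_zeta s"
  shows "uniform_limit (ball 0 (1/2))
     (\<lambda>M \<epsilon>. (\<Prod>i=1..r. w i) * (pole_poly r (of_nat r + \<epsilon>) * box_sum M (of_nat r + \<epsilon>)) - corner_sum M \<epsilon>)
     (\<lambda>\<epsilon>. (\<Prod>i=1..r. w i) * h (of_nat r + \<epsilon>)) sequentially"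
proof -
  let ?R = "\<lambda>M s. \<Sum>m\<in>{1..r} \<rightarrow>\<^sub>E {0..M}. remainder r m s"
  have sub: "cball (of_nat r) (1/2) \<subseteq> {s. Re s > 2 * real r - real r - 1}"
  proof
    fix s :: complex assume "s \<in> cball (of_nat r) (1/2)"
    then have "real r - Re s \<le> 1/2"
      using complex_Re_le_cmod[of "of_nat r - s"] by (simp add: dist_norm)
    then show "s \<in> {s. Re s > 2 * real r - real r - 1}"
      by simp
  qed
  have "uniform_limit (cball (of_nat r) (1/2)) ?R (remainder_sum r) sequentially"
    using lattice_dominated_box_limit[OF remainder_dominated _ compact_cball sub]
    unfolding remainder_sum_def[abs_def] by simp
  then have R: "uniform_limit (ball 0 (1/2)) (\<lambda>M \<epsilon>. ?R M (of_nat r + \<epsilon>))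
      (\<lambda>\<epsilon>. remainder_sum r (of_nat r + \<epsilon>)) sequentially"
    by (rule uniform_limit_compose') (auto simp: dist_norm)
  have lim: "uniform_limit (ball 0 (1/2))
      (\<lambda>M \<epsilon>. (log_power L a (- \<epsilon>) - ?R M (of_nat r + \<epsilon>)) + (corner_sum (M + 1) \<epsilon> - corner_sum M \<epsilon>))
      (\<lambda>\<epsilon>. (log_power L a (- \<epsilon>) - remainder_sum r (of_nat r + \<epsilon>)) + 0) sequentially"
    by (intro uniform_limit_add uniform_limit_minus uniform_limit_const R corner_sum_shift)
  have eq_box: "(log_power L a (- \<epsilon>) - ?R M (of_nat r + \<epsilon>)) + (corner_sum (M + 1) \<epsilon> - corner_sum M \<epsilon>)
      = (\<Prod>i=1..r. w i) * (pole_poly r (of_nat r + \<epsilon>) * box_sum M (of_nat r + \<epsilon>)) - corner_sum M \<epsilon>" for M \<epsilon>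
  proof -
    have "subset_sum_diff {1..r} (\<lambda>i. of_nat (M + 1) * w i) (\<lambda>x. log_power L x (- \<epsilon>)) a
        = log_power L a (- \<epsilon>) + corner_sum (M + 1) \<epsilon>"
      unfolding subset_sum_diff_def subset_multiple corner_sum_def
      by (subst sum.remove[of _ "{}"]) simp_all
    then show ?thesis
      using box_sum_remainder[of M "of_nat r + \<epsilon>" 0] coef_0
      by (simp add: falling_def algebra_simps)
  qed
  have eq_h: "(log_power L a (- \<epsilon>) - remainder_sum r (of_nat r + \<epsilon>)) + 0
      = (\<Prod>i=1..r. w i) * h (of_nat r + \<epsilon>)" if "\<epsilon> \<in> ball 0 (1/2)" for \<epsilon>
  proof -
    have "Re (of_nat r + \<epsilon>) > real r - 1"
      using that abs_Re_le_cmod[of \<epsilon>] by simp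
    then show ?thesis
      using entire_zeta_remainder[OF h] by simp
  qed
  show ?thesis
    by (rule uniform_limit_cong'[THEN iffD1, OF _ _ lim]) (rule eq_box, rule eq_h)
qed

end
context barnes_data
begin

definition box_fps :: "nat \<Rightarrow> complex fps" where
  "box_fps M = (\<Sum>m\<in>{1..r} \<rightarrow>\<^sub>E {0..M}. fps_const (log_power L (pt m) (- of_nat r)) * fps_exp (- L (pt m)))"

lemma has_fps_expansion_box_sum: "(\<lambda>\<epsilon>. box_sum M (of_nat r + \<epsilon>)) has_fps_expansion box_fps M"
proof -
  have "(\<lambda>\<epsilon>. \<Sum>m\<in>{1..r} \<rightarrow>\<^sub>E {0..M}. log_power L (pt m) (- of_nat r) * exp (- L (pt m) * \<epsilon>))
      has_fps_expansion box_fps M"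
    unfolding box_fps_def by (intro fps_expansion_intros)
  moreover have "log_power L z (- of_nat r) * exp (- L z * \<epsilon>) = log_power L z (- (of_nat r + \<epsilon>))" for z \<epsilon>
  proof -
    have "- of_nat r * L z + - L z * \<epsilon> = - (of_nat r + \<epsilon>) * L z"
      by (simp add: algebra_simps)
    then show ?thesis
      by (simp only: log_power_def exp_add[symmetric])
  qed
  ultimately show ?thesis
    by (simp only: box_sum_def)
qed

lemma box_fps_nth:
  "box_fps M $ k = (-1) ^ k / fact k * (\<Sum>m\<in>{1..r} \<rightarrow>\<^sub>E {0..M}. L (pt m) ^ k / pt m ^ r)"
proof -
  have "log_power L (pt m) (- of_nat r) = 1 / pt m ^ r" for m
  proof -
    have "exp (L (pt m)) = pt m"
      using L lattice_point_in_half_plane unfolding holomorphic_log_on_def by (simp only:)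
    then show ?thesis
      by (simp add: log_power_def exp_minus exp_of_nat_mult inverse_eq_divide)
  qed
  then show ?thesis
    by (simp add: box_fps_def fps_sum_nth sum_distrib_left power_minus[of "L _"] mult_ac)
qed

definition corner_fps :: "nat \<Rightarrow> complex fps" where
  "corner_fps n = (\<Sum>I\<in>Pow {1..r} - {{}}.
     fps_const ((-1) ^ card I) * fps_exp (- L (a + of_nat n * subset_sum I)))"

lemma has_fps_expansion_corner_sum: "corner_sum n has_fps_expansion corner_fps n"
proof -
  have "(\<lambda>\<epsilon>. \<Sum>I\<in>Pow {1..r} - {{}}. (-1) ^ card I * exp (- L (a + of_nat n * subset_sum I) * \<epsilon>))
      has_fps_expansion corner_fps n"
    unfolding corner_fps_def by (intro fps_expansion_intros)
  then show ?thesis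
    by (simp add: corner_sum_def[abs_def] log_power_def mult.commute)
qed

lemma corner_fps_nth:
  "corner_fps n $ p = (-1) ^ p / fact p *
     (\<Sum>I | I \<noteq> {} \<and> I \<subseteq> {1..r}. (-1) ^ card I * L (a + (\<Sum>i\<in>I. w i * of_nat n)) ^ p)"
proof -
  have "Pow {1..r} - {{}} = {I. I \<noteq> {} \<and> I \<subseteq> {1..r}}"
    by auto
  moreover have "of_nat n * subset_sum I = (\<Sum>i\<in>I. w i * of_nat n)" for I
    by (simp add: sum_distrib_left mult.commute)
  ultimately show ?thesis
    by (simp add: corner_fps_def fps_sum_nth sum_distrib_left power_minus[of "L _"] mult_ac)
qed

text \<open>Near \<open>s = r\<close> the continued function is an entire function divided by \<open>\<epsilon>\<close> and the cofactor,
  so its Laurent coefficients are those of a product of two power series.\<close>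

lemma barnes_gamma_eq:
  assumes r: "r \<ge> 1"
    and c: "(\<lambda>\<epsilon>. 1 / pole_cofactor r \<epsilon>) has_fps_expansion Abs_fps c"
    and h: "h holomorphic_on UNIV" "\<And>s. Re s > real r \<Longrightarrow> h s = entire_zeta s"
    and H: "(\<lambda>\<epsilon>. h (of_nat r + \<epsilon>)) has_fps_expansion H"
  shows "barnes_gamma L r a w k = (Abs_fps c * H) $ (k + 1)"
proof -
  define f where "f = (\<lambda>s. h s / pole_poly r s)"
  have "(\<lambda>\<epsilon>. 1 / pole_cofactor r \<epsilon> * h (of_nat r + \<epsilon>)) has_fps_expansion Abs_fps c * H"
    by (intro has_fps_expansion_mult c H)
  then have "(\<lambda>\<epsilon>. 1 / pole_cofactor r \<epsilon> * h (of_nat r + \<epsilon>) * \<epsilon> powi (-1))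
      has_laurent_expansion fls_shift 1 (fps_to_fls (Abs_fps c * H))"
    by (intro has_laurent_expansion_shift' has_laurent_expansion_fps)
  moreover have "1 / pole_cofactor r \<epsilon> * h (of_nat r + \<epsilon>) * \<epsilon> powi (-1) = f (of_nat r + \<epsilon>)" for \<epsilon>
    unfolding f_def pole_poly_at_pole[OF r] by (simp add: power_int_minus field_simps)
  ultimately have f: "(\<lambda>\<epsilon>. f (of_nat r + \<epsilon>)) has_laurent_expansion
      fls_shift 1 (fps_to_fls (Abs_fps c * H))"
    by (simp only:)
  have zeta: "barnes_zeta L r a w = remove_sings f"
    unfolding f_def by (rule barnes_zeta_eq[OF h(1)]) (rule h(2))
  have "f meromorphic_on {of_nat r}"
    using f by (auto simp: meromorphic_on_def)
  then have "\<forall>\<^sub>F s in at (of_nat r). remove_sings f s = f s"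
    by (intro eventually_remove_sings_eq_at) (auto simp: meromorphic_at_iff)
  then have "laurent_expansion (remove_sings f) (of_nat r) = laurent_expansion f (of_nat r)"
    by (rule laurent_expansion_cong) simp
  also have "\<dots> = fls_shift 1 (fps_to_fls (Abs_fps c * H))"
    using f by (rule laurent_expansion_eqI)
  finally have "barnes_gamma L r a w k = fls_nth (fls_shift 1 (fps_to_fls (Abs_fps c * H))) (int k)"
    unfolding barnes_gamma_def zeta by simp
  also have "\<dots> = (Abs_fps c * H) $ (k + 1)"
    by (simp add: nat_add_distrib)
  finally show ?thesis .
qed

text \<open>Multiplying the Taylor series of the approximating functions by the series of the \<open>c\<^sub>q\<close> cancels the
  cofactor in front of the box sum and leaves it as a factor of the corner terms only. This accounts
  for the convolution in the limit formula, and the factor \<open>\<epsilon>\<close> for its upper index \<open>k + 1\<close>.\<close>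

theorem barnes_gamma_limit:
  assumes r: "r \<ge> 1"
    and c: "\<And>\<epsilon>::complex. norm \<epsilon> < 1 \<Longrightarrow>
              (\<lambda>q. c q * \<epsilon> ^ q) sums (1 / (\<Prod>j = 1..r - 1. (of_nat j + \<epsilon>)))"
  shows "(\<lambda>M. box_fps M $ k - 1 / (\<Prod>i = 1..r. w i) * (\<Sum>q = 0..k + 1. c q * corner_fps M $ (k + 1 - q)))
     \<longlonglongrightarrow> barnes_gamma L r a w k"
proof -
  define W where "W = (\<Prod>i = 1..r. w i)"
  have recip: "(\<lambda>\<epsilon>. 1 / pole_cofactor r \<epsilon>) has_fps_expansion Abs_fps c"
    by (rule reciprocal_coefficients(1)) (rule c)
  have cofactor: "Abs_fps c * pole_cofactor_fps r = 1"
    by (rule reciprocal_coefficients(2)) (rule c)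
  have W: "W \<noteq> 0"
    unfolding W_def by (rule prod_w_nonzero)
  obtain h where h: "h holomorphic_on UNIV" "\<forall>s. Re s > real r \<longrightarrow> h s = entire_zeta s"
    using continuation by (elim exE conjE)
  have h': "h s = entire_zeta s" if "Re s > real r" for s
    using h(2) that by simp
  define H where "H = fps_expansion (\<lambda>\<epsilon>. h (of_nat r + \<epsilon>)) 0"
  have "(h \<circ> (\<lambda>\<epsilon>. of_nat r + \<epsilon>)) holomorphic_on UNIV"
    by (rule holomorphic_on_compose_gen[OF _ h(1)]) (auto intro: holomorphic_intros)
  then have H: "(\<lambda>\<epsilon>. h (of_nat r + \<epsilon>)) has_fps_expansion H"
    unfolding H_def o_def by (intro has_fps_expansion_fps_expansion[of UNIV]) simp_all
  define E where "E = (\<lambda>M \<epsilon>. W * (pole_poly r (of_nat r + \<epsilon>) * box_sum M (of_nat r + \<epsilon>)) - corner_sum M \<epsilon>)"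
  define E_fps where "E_fps = (\<lambda>M. fps_const W * (fps_X * pole_cofactor_fps r * box_fps M) - corner_fps M)"
  have E_fps: "E M has_fps_expansion E_fps M" for M
    unfolding E_def E_fps_def pole_poly_at_pole[OF r]
    by (intro fps_expansion_intros has_fps_expansion_pole_cofactor has_fps_expansion_box_sum
        has_fps_expansion_corner_sum)
  have holo: "E M holomorphic_on ball 0 (1/2)" for M
    unfolding E_def pole_poly_def box_sum_def corner_sum_def log_power_def by (intro holomorphic_intros)
  \<comment> \<open>Uniform convergence near \<open>0\<close> gives convergence of every Taylor coefficient.\<close>
  have "(\<lambda>M. E_fps M $ j) \<longlonglongrightarrow> (fps_const W * H) $ j" for j
  proof -
    have "(\<lambda>M. (deriv ^^ j) (E M) 0) \<longlonglongrightarrow> (deriv ^^ j) (\<lambda>\<epsilon>. W * h (of_nat r + \<epsilon>)) 0"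
      using numerator_uniform_limit[OF h(1) h'] holo unfolding E_def W_def
      by (intro higher_deriv_complex_uniform_limit[where A = "ball 0 (1/2)"] always_eventually allI) simp_all
    then have "(\<lambda>M. (deriv ^^ j) (E M) 0 / fact j) \<longlonglongrightarrow> (deriv ^^ j) (\<lambda>\<epsilon>. W * h (of_nat r + \<epsilon>)) 0 / fact j"
      by (intro tendsto_divide tendsto_const) simp_all
    moreover have "(\<lambda>\<epsilon>. W * h (of_nat r + \<epsilon>)) has_fps_expansion fps_const W * H"
      by (intro fps_expansion_intros H)
    ultimately show ?thesis
      by (simp only: fps_nth_fps_expansion[OF E_fps] fps_nth_fps_expansion)
  qed
  then have "(\<lambda>M. (Abs_fps c * E_fps M) $ (k + 1)) \<longlonglongrightarrow> (Abs_fps c * (fps_const W * H)) $ (k + 1)"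
    unfolding fps_mult_nth[of "Abs_fps c"] by (intro tendsto_sum tendsto_mult tendsto_const)
  moreover have "Abs_fps c * (fps_const W * H) = fps_const W * (Abs_fps c * H)"
    by (simp add: mult_ac)
  moreover have "Abs_fps c * E_fps M = fps_const W * (fps_X * box_fps M) - Abs_fps c * corner_fps M" for M
  proof -
    have "Abs_fps c * E_fps M
        = fps_const W * (fps_X * (Abs_fps c * pole_cofactor_fps r) * box_fps M) - Abs_fps c * corner_fps M"
      by (simp add: E_fps_def algebra_simps)
    then show ?thesis
      unfolding cofactor by simp
  qed
  ultimately have "(\<lambda>M. W * box_fps M $ k - (Abs_fps c * corner_fps M) $ (k + 1))
      \<longlonglongrightarrow> W * (Abs_fps c * H) $ (k + 1)"
    by simp
  then have "(\<lambda>M. (W * box_fps M $ k - (Abs_fps c * corner_fps M) $ (k + 1)) / W)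
      \<longlonglongrightarrow> W * (Abs_fps c * H) $ (k + 1) / W"
    by (intro tendsto_divide tendsto_const W)
  moreover have "W * (Abs_fps c * H) $ (k + 1) / W = barnes_gamma L r a w k"
    using barnes_gamma_eq[OF r recip h(1) h(2)[rule_format] H] W by simp
  moreover have "(W * box_fps M $ k - (Abs_fps c * corner_fps M) $ (k + 1)) / W
      = box_fps M $ k - 1 / W * (\<Sum>q = 0..k + 1. c q * corner_fps M $ (k + 1 - q))" for M
    using W by (simp add: fps_mult_nth diff_divide_distrib)
  ultimately show ?thesis
    unfolding W_def by (simp only:)
qed

end

section \<open>The limit formula\<close>

theorem theorem1p2:
  fixes r :: nat and \<phi> :: real and a :: complex and w :: "nat \<Rightarrow> complex"
    and L :: "complex \<Rightarrow> complex" and c :: "nat \<Rightarrow> complex"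
  assumes r: "r \<ge> 2"
    and phi: "- pi < \<phi>" "\<phi> < pi"
    and L: "holomorphic_log_on L (half_plane \<phi>)"
    and a: "a \<in> half_plane \<phi>"
    and w: "\<And>i. i \<in> {1..r} \<Longrightarrow> w i \<in> half_plane \<phi>"
    and c: "\<And>\<epsilon>::complex. norm \<epsilon> < 1 \<Longrightarrow>
              (\<lambda>q. c q * \<epsilon> ^ q) sums (1 / (\<Prod>j = 1..r - 1. (of_nat j + \<epsilon>)))"
  shows "(\<forall>k::nat.
     (\<lambda>M::nat.
        (- 1) ^ k / fact k *
          (\<Sum>m \<in> {1..r} \<rightarrow>\<^sub>E {0..M}. L (lattice_point r a w m) ^ k / lattice_point r a w m ^ r)
        - 1 / (\<Prod>i = 1..r. w i) *
          (\<Sum>q = 0..k + 1. c q * ((- 1) ^ (k + 1 - q) / fact (k + 1 - q)) *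
             (\<Sum>I | I \<noteq> {} \<and> I \<subseteq> {1..r}.
                (- 1) ^ card I * L (a + (\<Sum>i\<in>I. w i * of_nat M)) ^ (k + 1 - q))))
     \<longlonglongrightarrow> barnes_gamma L r a w k)
   \<and> (\<lambda>M::nat.
        (\<Sum>m \<in> {1..r} \<rightarrow>\<^sub>E {0..M}. 1 / lattice_point r a w m ^ r)
        + 1 / (fact (r - 1) * (\<Prod>i = 1..r. w i)) *
          (\<Sum>I | I \<noteq> {} \<and> I \<subseteq> {1..r}. (- 1) ^ card I * L (a + (\<Sum>i\<in>I. w i * of_nat M)))
        - harm (r - 1) / (fact (r - 1) * (\<Prod>i = 1..r. w i)))
     \<longlonglongrightarrow> barnes_gamma L r a w 0"
proof -
  interpret barnes_data L r \<phi> a w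
    using L a w by unfold_locales
  have r1: "r \<ge> 1"
    using r by simp
  have lim: "(\<lambda>M. (- 1) ^ k / fact k *
          (\<Sum>m \<in> {1..r} \<rightarrow>\<^sub>E {0..M}. L (lattice_point r a w m) ^ k / lattice_point r a w m ^ r)
        - 1 / (\<Prod>i = 1..r. w i) *
          (\<Sum>q = 0..k + 1. c q * ((- 1) ^ (k + 1 - q) / fact (k + 1 - q)) *
             (\<Sum>I | I \<noteq> {} \<and> I \<subseteq> {1..r}.
                (- 1) ^ card I * L (a + (\<Sum>i\<in>I. w i * of_nat M)) ^ (k + 1 - q))))
     \<longlonglongrightarrow> barnes_gamma L r a w k" for k
  proof -
    have "(\<lambda>M. box_fps M $ k - 1 / (\<Prod>i = 1..r. w i) * (\<Sum>q = 0..k + 1. c q * corner_fps M $ (k + 1 - q)))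
        \<longlonglongrightarrow> barnes_gamma L r a w k"
      by (rule barnes_gamma_limit[OF r1]) (rule c)
    then show ?thesis
      unfolding box_fps_nth corner_fps_nth mult.assoc .
  qed
  moreover have "(\<lambda>M::nat.
        (\<Sum>m \<in> {1..r} \<rightarrow>\<^sub>E {0..M}. 1 / lattice_point r a w m ^ r)
        + 1 / (fact (r - 1) * (\<Prod>i = 1..r. w i)) *
          (\<Sum>I | I \<noteq> {} \<and> I \<subseteq> {1..r}. (- 1) ^ card I * L (a + (\<Sum>i\<in>I. w i * of_nat M)))
        - harm (r - 1) / (fact (r - 1) * (\<Prod>i = 1..r. w i)))
     \<longlonglongrightarrow> barnes_gamma L r a w 0"
  proof -
    have "Abs_fps c * pole_cofactor_fps r = 1"
      by (rule reciprocal_coefficients(2)) (rule c)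
    then have "(Abs_fps c * pole_cofactor_fps r) $ 0 = 1" "(Abs_fps c * pole_cofactor_fps r) $ 1 = 0"
      by simp_all
    then have c_eqs: "c 0 * fact (r - 1) = 1" "c 0 * (fact (r - 1) * harm (r - 1)) + c 1 * fact (r - 1) = 0"
      by (simp_all add: fps_mult_nth pole_cofactor_fps_nth_0 pole_cofactor_fps_nth_1[simplified])
    have c0: "c 0 = 1 / fact (r - 1)"
      using c_eqs(1) by (simp add: field_simps)
    have c1: "c 1 = - harm (r - 1) / fact (r - 1)"
    proof -
      have "c 1 * fact (r - 1) = - (c 0 * fact (r - 1)) * harm (r - 1)"
        using c_eqs(2) by (simp add: eq_neg_iff_add_eq_0 algebra_simps)
      then show ?thesis
        unfolding c_eqs(1) by (simp add: field_simps)
    qed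
    \<comment> \<open>The zeroth powers of the logarithms sum to \<open>-1\<close>: all signed subsets cancel, and the empty
      one is left out.\<close>
    have "(\<Sum>I\<in>Pow {1..r}. (-1) ^ card I :: complex) = 0"
      using subset_sum_diff_power[of "{1..r}" 0 "\<lambda>_. 1"] r1 by (simp add: subset_sum_diff_def)
    moreover have "Pow {1..r} = insert {} {I. I \<noteq> {} \<and> I \<subseteq> {1..r}}"
      by auto
    moreover have "finite {I. I \<noteq> {} \<and> I \<subseteq> {1..r}}"
      by (rule finite_subset[of _ "Pow {1..r}"]) auto
    ultimately have signs: "(\<Sum>I | I \<noteq> {} \<and> I \<subseteq> {1..r}. (-1) ^ card I :: complex) = -1"
      by (simp add: eq_neg_iff_add_eq_0 add.commute)
    have "(\<Sum>q = 0..0 + 1. c q * ((- 1) ^ (0 + 1 - q) / fact (0 + 1 - q)) *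
             (\<Sum>I | I \<noteq> {} \<and> I \<subseteq> {1..r}.
                (- 1) ^ card I * L (a + (\<Sum>i\<in>I. w i * of_nat M)) ^ (0 + 1 - q)))
        = - (c 0 * (\<Sum>I | I \<noteq> {} \<and> I \<subseteq> {1..r}. (- 1) ^ card I * L (a + (\<Sum>i\<in>I. w i * of_nat M)))) - c 1" for M
      using signs by simp
    from lim[of 0, unfolded this] show ?thesis
      unfolding c0 c1 by (simp add: algebra_simps)
  qed
  ultimately show ?thesis
    by blast
qed

end
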